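(* Let $n\ge 1$. The group $\mathrm{SL}_*^1(2,A_n)$ is presented by the generators $h_t$ ($t\in A_n^{\times}$), $u_s$ ($s\in A_n^{\mathrm{asym}}$) and $w$, subject to the relations \begin{align*} & h_{t_1}h_{t_2}=h_{t_1t_2} && (t_1,t_2\in A_n^{\times}),\\ & u_{s_1}u_{s_2}=u_{s_1+s_2} && (s_1,s_2\in A_n^{\mathrm{asym}}),\\ & h_tu_s=u_{tst^*}h_t && (t\in A_n^{\times},\ s\in A_n^{\mathrm{asym}}),\\ & w^2=1, &&\\ & h_tw=w\,h_{(t^* )^{-1}} && (t\in A_n^{\times}),\\ & w\,u_{t^{-1}}\,w\,u_{-t}\,w\,u_{t^{-1}}=h_{-t} && (t\in A_n^{\times}\cap A_n^{\mathrm{asym}}), \end{align*} where $h_t,u_s,w$ are interpreted in $\mathrm{SL}_*^1(2,A_n)$ as the matrices $$h_t=\begin{pmatrix} t&0\\0&(t^{*})^{-1}\end{pmatrix},\qquad u_s=\begin{pmatrix}1&s\\0&1\end{pmatrix},\qquad w=\begin{pmatrix}0&1\\1&0\end{pmatrix}.$$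
   Context: Let $k$ be a finite field with $q$ elements, $q$ a power of an odd prime $p$, and let $K$ be its quadratic extension; fix $\Delta\in K$ with $K=k(\Delta)$ and $\Delta^2\in k$, and let $\overline{a+b\Delta}=a-b\Delta$ ($a,b\in k$). Let $A_n=K[x]/\langle x^n\rangle$, with the $k$-algebra involution $*$ determined by $z^*=\overline{z}$ for $z\in K$ and $x^*=-x$, i.e. $\left(\sum_{i} a_ix^i\right)^*=\sum_{i}(-1)^i\overline{a_i}x^i$. $A_n^{\times}$ is the group of units and $A_n^{\mathrm{asym}}=\{a\in A_n: a^*=-a\}$. For $g\in M(2,A_n)$ let $g^*$ be given by $(g^* )_{ij}=(g_{ji})^*$, let $J=\begin{pmatrix}0&1\\1&0\end{pmatrix}$, and let $\mathrm{SL}_*^1(2,A_n)=\{g\in M(2,A_n): g^*Jg=J\}$ (a group under matrix multiplication). *)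

theory Defs
  imports
    "HOL-Algebra.Algebra"
    "HOL-Analysis.Finite_Cartesian_Product"
begin

section \<open>Groups given by generators and relations\<close>

text \<open>
  A letter \<open>(x, True)\<close> stands for \<open>x\<close> and \<open>(x, False)\<close> for its formal inverse.
  The free group on \<open>S\<close> consists of the words over \<open>S\<close> modulo free cancellation.
\<close>

type_synonym 'g word = "('g \<times> bool) list"

definition words :: "'g set \<Rightarrow> 'g word set" where
  "words S = lists (S \<times> UNIV)"

inductive word_eq :: "'g set \<Rightarrow> 'g word \<Rightarrow> 'g word \<Rightarrow> bool" for S :: "'g set" where
  refl: "w \<in> words S \<Longrightarrow> word_eq S w w"
| sym: "word_eq S v w \<Longrightarrow> word_eq S w v"
| trans: "word_eq S u v \<Longrightarrow> word_eq S v w \<Longrightarrow> word_eq S u w"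
| cancel: "u \<in> words S \<Longrightarrow> v \<in> words S \<Longrightarrow> x \<in> S \<Longrightarrow>
    word_eq S (u @ [(x, b), (x, \<not> b)] @ v) (u @ v)"

definition word_rel :: "'g set \<Rightarrow> ('g word \<times> 'g word) set" where
  "word_rel S = {(v, w). word_eq S v w}"

definition free_group :: "'g set \<Rightarrow> 'g word set monoid" where
  "free_group S =
    \<lparr>carrier = words S // word_rel S,
     monoid.mult = (\<lambda>C D. \<Union>v\<in>C. \<Union>w\<in>D. word_rel S `` {v @ w}),
     monoid.one = word_rel S `` {[]}\<rparr>"

definition free_gen :: "'g set \<Rightarrow> 'g \<Rightarrow> 'g word set" where
  "free_gen S x = word_rel S `` {[(x, True)]}"

definition normal_closure :: "('a, 'm) monoid_scheme \<Rightarrow> 'a set \<Rightarrow> 'a set" where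
  "normal_closure G H =
    generate G {g \<otimes>\<^bsub>G\<^esub> r \<otimes>\<^bsub>G\<^esub> inv\<^bsub>G\<^esub> g | g r. g \<in> carrier G \<and> r \<in> H}"

text \<open>
  A relation \<open>l = r\<close> is a pair \<open>(l, r)\<close> of elements of the free group; it contributes
  the relator \<open>l r\<inverse>\<close>.
\<close>

definition relator_subgroup ::
    "'g set \<Rightarrow> ('g word set \<times> 'g word set) set \<Rightarrow> 'g word set set" where
  "relator_subgroup S R =
    normal_closure (free_group S)
      {l \<otimes>\<^bsub>free_group S\<^esub> inv\<^bsub>free_group S\<^esub> r | l r. (l, r) \<in> R}"

definition presented_group ::
    "'g set \<Rightarrow> ('g word set \<times> 'g word set) set \<Rightarrow> 'g word set set monoid" where
  "presented_group S R = free_group S Mod relator_subgroup S R"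

definition presented_gen ::
    "'g set \<Rightarrow> ('g word set \<times> 'g word set) set \<Rightarrow> 'g \<Rightarrow> 'g word set set" where
  "presented_gen S R x = relator_subgroup S R #>\<^bsub>free_group S\<^esub> free_gen S x"

text \<open>
  \<open>G\<close> is presented by the generators \<open>S\<close> and the relations \<open>R\<close>, where the generator
  \<open>x\<close> is interpreted in \<open>G\<close> as \<open>f x\<close>.
\<close>

definition is_presented_by ::
    "('b, 'm) monoid_scheme \<Rightarrow> 'g set \<Rightarrow> ('g word set \<times> 'g word set) set \<Rightarrow> ('g \<Rightarrow> 'b) \<Rightarrow> bool"
where
  "is_presented_by G S R f \<longleftrightarrow>
    (\<exists>\<phi> \<in> iso (presented_group S R) G. \<forall>x\<in>S. \<phi> (presented_gen S R x) = f x)"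

lemma words_simps [simp]:
  "[] \<in> words S"
  "a # w \<in> words S \<longleftrightarrow> fst a \<in> S \<and> w \<in> words S"
  "v @ w \<in> words S \<longleftrightarrow> v \<in> words S \<and> w \<in> words S"
  by (cases a; auto simp: words_def)+

lemma word_eq_words: "word_eq S v w \<Longrightarrow> v \<in> words S \<and> w \<in> words S"
  by (induction rule: word_eq.induct) auto

lemma word_eq_append_left: "word_eq S v w \<Longrightarrow> u \<in> words S \<Longrightarrow> word_eq S (u @ v) (u @ w)"
proof (induction rule: word_eq.induct)
  case (cancel u' v x b)
  then show ?case using word_eq.cancel[of "u @ u'" S v x b] by simp
qed (auto intro: word_eq.intros)

lemma word_eq_append_right: "word_eq S v w \<Longrightarrow> u \<in> words S \<Longrightarrow> word_eq S (v @ u) (w @ u)"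
proof (induction rule: word_eq.induct)
  case (cancel u' v x b)
  then show ?case using word_eq.cancel[of u' S "v @ u" x b] by simp
qed (auto intro: word_eq.intros)

lemma word_eq_append:
  assumes "word_eq S v v'" "word_eq S w w'"
  shows "word_eq S (v @ w) (v' @ w')"
  using assms word_eq_append_left word_eq_append_right word_eq.trans word_eq_words by metis

lemma equiv_word_rel: "equiv (words S) (word_rel S)"
proof (rule equivI)
  show "word_rel S \<subseteq> words S \<times> words S"
    using word_eq_words by (auto simp: word_rel_def)
  show "refl_on (words S) (word_rel S)"
    by (auto simp: refl_on_def word_rel_def intro: word_eq.refl)
  show "sym (word_rel S)"
    by (auto simp: sym_on_def word_rel_def intro: word_eq.sym)
  show "trans (word_rel S)"
    by (auto simp: trans_def word_rel_def intro: word_eq.trans)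
qed

lemma free_group_mult_class:
  assumes "v \<in> words S" "w \<in> words S"
  shows "word_rel S `` {v} \<otimes>\<^bsub>free_group S\<^esub> word_rel S `` {w} = word_rel S `` {v @ w}"
proof -
  have "word_rel S `` {v' @ w'} = word_rel S `` {v @ w}"
    if "v' \<in> word_rel S `` {v}" "w' \<in> word_rel S `` {w}" for v' w'
    using that by (intro equiv_class_eq[OF equiv_word_rel])
      (auto simp: word_rel_def intro: word_eq_append word_eq.sym)
  then have "(\<Union>v'\<in>word_rel S `` {v}. \<Union>w'\<in>word_rel S `` {w}. word_rel S `` {v' @ w'}) =
      (\<Union>v'\<in>word_rel S `` {v}. \<Union>w'\<in>word_rel S `` {w}. word_rel S `` {v @ w})"
    by (intro SUP_cong) simp_all
  moreover have "word_rel S `` {v} \<noteq> {}" "word_rel S `` {w} \<noteq> {}"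
    using assms by (auto simp: word_rel_def intro: word_eq.refl)
  ultimately show ?thesis
    by (simp add: free_group_def)
qed

definition inv_word :: "'g word \<Rightarrow> 'g word" where
  "inv_word w = rev (map (\<lambda>(x, b). (x, \<not> b)) w)"

lemma inv_word_words [simp]: "inv_word w \<in> words S \<longleftrightarrow> w \<in> words S"
  by (induction w) (auto simp: inv_word_def)

lemma word_eq_inv_word: "w \<in> words S \<Longrightarrow> word_eq S (inv_word w @ w) []"
proof (induction w)
  case Nil
  then show ?case by (simp add: inv_word_def word_eq.refl)
next
  case (Cons a w)
  obtain x b where a: "a = (x, b)" by (cases a)
  have "word_eq S (inv_word w @ [(x, \<not> b), (x, \<not> \<not> b)] @ w) (inv_word w @ w)"
    using Cons.prems a by (intro word_eq.cancel) auto
  moreover have "inv_word (a # w) @ a # w = inv_word w @ [(x, \<not> b), (x, \<not> \<not> b)] @ w"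
    by (simp add: inv_word_def a)
  ultimately show ?case
    using Cons by (auto intro: word_eq.trans)
qed

lemma group_free_group: "group (free_group S)"
proof (rule groupI)
  note carr = free_group_def quotient_def
  have cl: "C \<in> carrier (free_group S) \<longleftrightarrow> (\<exists>w\<in>words S. C = word_rel S `` {w})" for C
    by (auto simp: carr)
  have one: "\<one>\<^bsub>free_group S\<^esub> = word_rel S `` {[]}"
    by (simp add: free_group_def)
  fix C assume "C \<in> carrier (free_group S)"
  then obtain u where u: "u \<in> words S" "C = word_rel S `` {u}" by (auto simp: cl)
  show "\<one>\<^bsub>free_group S\<^esub> \<otimes>\<^bsub>free_group S\<^esub> C = C"
    using u by (simp add: one free_group_mult_class)
  show "\<exists>D\<in>carrier (free_group S). D \<otimes>\<^bsub>free_group S\<^esub> C = \<one>\<^bsub>free_group S\<^esub>"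
  proof
    show "word_rel S `` {inv_word u} \<in> carrier (free_group S)"
      using u by (auto simp: cl)
    have "word_rel S `` {inv_word u @ u} = word_rel S `` {[]}"
      using word_eq_inv_word[OF u(1)]
      by (intro equiv_class_eq[OF equiv_word_rel]) (simp add: word_rel_def)
    then show "word_rel S `` {inv_word u} \<otimes>\<^bsub>free_group S\<^esub> C = \<one>\<^bsub>free_group S\<^esub>"
      using u by (simp add: one free_group_mult_class)
  qed
  fix D assume "D \<in> carrier (free_group S)"
  then obtain v where v: "v \<in> words S" "D = word_rel S `` {v}" by (auto simp: cl)
  have "v \<in> words S \<Longrightarrow> u @ v \<in> words S" using u by simp
  then show "C \<otimes>\<^bsub>free_group S\<^esub> D \<in> carrier (free_group S)"
    using u v by (auto simp: free_group_mult_class cl)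
  fix E assume "E \<in> carrier (free_group S)"
  then obtain w where w: "w \<in> words S" "E = word_rel S `` {w}" by (auto simp: cl)
  show "C \<otimes>\<^bsub>free_group S\<^esub> D \<otimes>\<^bsub>free_group S\<^esub> E = C \<otimes>\<^bsub>free_group S\<^esub> (D \<otimes>\<^bsub>free_group S\<^esub> E)"
    using u v w by (simp add: free_group_mult_class)
next
  show "\<one>\<^bsub>free_group S\<^esub> \<in> carrier (free_group S)"
    unfolding free_group_def by (auto intro: quotientI)
qed

lemma free_gen_closed: "x \<in> S \<Longrightarrow> free_gen S x \<in> carrier (free_group S)"
  by (auto simp: free_gen_def free_group_def intro!: quotientI)

lemma (in group) normal_closure_normal:
  assumes "H \<subseteq> carrier G"
  shows "normal_closure G H \<lhd> G"
  unfolding normal_closure_def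
proof (rule normal_generateI)
  show "{g \<otimes> r \<otimes> inv g | g r. g \<in> carrier G \<and> r \<in> H} \<subseteq> carrier G"
    using assms by auto
next
  fix h g
  assume "h \<in> {g \<otimes> r \<otimes> inv g | g r. g \<in> carrier G \<and> r \<in> H}" and g: "g \<in> carrier G"
  then obtain a r where ar: "a \<in> carrier G" "r \<in> H" "h = a \<otimes> r \<otimes> inv a" by auto
  then have "g \<otimes> h \<otimes> inv g = (g \<otimes> a) \<otimes> r \<otimes> inv (g \<otimes> a)"
    using g assms by (simp add: m_assoc inv_mult_group subset_iff)
  then show "g \<otimes> h \<otimes> inv g \<in> {g \<otimes> r \<otimes> inv g | g r. g \<in> carrier G \<and> r \<in> H}"
    using ar g by blast
qed

lemma group_presented_group:
  assumes "R \<subseteq> carrier (free_group S) \<times> carrier (free_group S)"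
  shows "group (presented_group S R)"
proof -
  interpret group "free_group S" by (rule group_free_group)
  have "{l \<otimes>\<^bsub>free_group S\<^esub> inv\<^bsub>free_group S\<^esub> r | l r. (l, r) \<in> R} \<subseteq> carrier (free_group S)"
    using assms by auto
  from normal_closure_normal[OF this] show ?thesis
    unfolding presented_group_def relator_subgroup_def by (rule normal.factorgroup_is_group)
qed


section \<open>The group \<open>SL\<^sub>*\<^sup>1(2, R)\<close> of a ring \<open>R\<close> with involution \<open>s\<close>\<close>

definition asym_elems :: "('a, 'm) ring_scheme \<Rightarrow> ('a \<Rightarrow> 'a) \<Rightarrow> 'a set" where
  "asym_elems R s = {a \<in> carrier R. s a = \<ominus>\<^bsub>R\<^esub> a}"

definition mat2 :: "'a \<Rightarrow> 'a \<Rightarrow> 'a \<Rightarrow> 'a \<Rightarrow> 'a^2^2" where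
  "mat2 a b c d = (\<chi> i j. if i = 1 then (if j = 1 then a else b) else (if j = 1 then c else d))"

definition mat_mult :: "('a, 'm) ring_scheme \<Rightarrow> 'a^2^2 \<Rightarrow> 'a^2^2 \<Rightarrow> 'a^2^2" where
  "mat_mult R g h = (\<chi> i j. \<Oplus>\<^bsub>R\<^esub>l\<in>UNIV. g $ i $ l \<otimes>\<^bsub>R\<^esub> h $ l $ j)"

definition mat_star :: "('a \<Rightarrow> 'a) \<Rightarrow> 'a^2^2 \<Rightarrow> 'a^2^2" where
  "mat_star s g = (\<chi> i j. s (g $ j $ i))"

definition mat_J :: "('a, 'm) ring_scheme \<Rightarrow> 'a^2^2" where
  "mat_J R = mat2 \<zero>\<^bsub>R\<^esub> \<one>\<^bsub>R\<^esub> \<one>\<^bsub>R\<^esub> \<zero>\<^bsub>R\<^esub>"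

definition SL_star1 :: "('a, 'm) ring_scheme \<Rightarrow> ('a \<Rightarrow> 'a) \<Rightarrow> ('a^2^2) monoid" where
  "SL_star1 R s =
    \<lparr>carrier = {g. (\<forall>i j. g $ i $ j \<in> carrier R) \<and>
                   mat_mult R (mat_mult R (mat_star s g) (mat_J R)) g = mat_J R},
     monoid.mult = mat_mult R,
     monoid.one = mat2 \<one>\<^bsub>R\<^esub> \<zero>\<^bsub>R\<^esub> \<zero>\<^bsub>R\<^esub> \<one>\<^bsub>R\<^esub>\<rparr>"

datatype 'a bruhat_gen = H 'a | U 'a | W

definition bruhat_gens :: "('a, 'm) ring_scheme \<Rightarrow> ('a \<Rightarrow> 'a) \<Rightarrow> 'a bruhat_gen set" where
  "bruhat_gens R s = H ` Units R \<union> U ` asym_elems R s \<union> {W}"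

definition bruhat_rels :: "('a, 'm) ring_scheme \<Rightarrow> ('a \<Rightarrow> 'a) \<Rightarrow>
    ('a bruhat_gen word set \<times> 'a bruhat_gen word set) set" where
  "bruhat_rels R s =
    (let F = free_group (bruhat_gens R s);
         h = (\<lambda>t. free_gen (bruhat_gens R s) (H t));
         u = (\<lambda>a. free_gen (bruhat_gens R s) (U a));
         w = free_gen (bruhat_gens R s) W
     in {(h t\<^sub>1 \<otimes>\<^bsub>F\<^esub> h t\<^sub>2, h (t\<^sub>1 \<otimes>\<^bsub>R\<^esub> t\<^sub>2)) | t\<^sub>1 t\<^sub>2. t\<^sub>1 \<in> Units R \<and> t\<^sub>2 \<in> Units R}
      \<union> {(u a\<^sub>1 \<otimes>\<^bsub>F\<^esub> u a\<^sub>2, u (a\<^sub>1 \<oplus>\<^bsub>R\<^esub> a\<^sub>2)) | a\<^sub>1 a\<^sub>2. a\<^sub>1 \<in> asym_elems R s \<and> a\<^sub>2 \<in> asym_elems R s}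
      \<union> {(h t \<otimes>\<^bsub>F\<^esub> u a, u (t \<otimes>\<^bsub>R\<^esub> a \<otimes>\<^bsub>R\<^esub> s t) \<otimes>\<^bsub>F\<^esub> h t) | t a. t \<in> Units R \<and> a \<in> asym_elems R s}
      \<union> {(w \<otimes>\<^bsub>F\<^esub> w, \<one>\<^bsub>F\<^esub>)}
      \<union> {(h t \<otimes>\<^bsub>F\<^esub> w, w \<otimes>\<^bsub>F\<^esub> h (inv\<^bsub>R\<^esub> (s t))) | t. t \<in> Units R}
      \<union> {(w \<otimes>\<^bsub>F\<^esub> u (inv\<^bsub>R\<^esub> t) \<otimes>\<^bsub>F\<^esub> w \<otimes>\<^bsub>F\<^esub> u (\<ominus>\<^bsub>R\<^esub> t) \<otimes>\<^bsub>F\<^esub> w \<otimes>\<^bsub>F\<^esub> u (inv\<^bsub>R\<^esub> t), h (\<ominus>\<^bsub>R\<^esub> t))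
          | t. t \<in> Units R \<inter> asym_elems R s})"

primrec bruhat_matrix :: "('a, 'm) ring_scheme \<Rightarrow> ('a \<Rightarrow> 'a) \<Rightarrow> 'a bruhat_gen \<Rightarrow> 'a^2^2" where
  "bruhat_matrix R s (H t) = mat2 t \<zero>\<^bsub>R\<^esub> \<zero>\<^bsub>R\<^esub> (inv\<^bsub>R\<^esub> (s t))"
| "bruhat_matrix R s (U a) = mat2 \<one>\<^bsub>R\<^esub> a \<zero>\<^bsub>R\<^esub> \<one>\<^bsub>R\<^esub>"
| "bruhat_matrix R s W = mat2 \<zero>\<^bsub>R\<^esub> \<one>\<^bsub>R\<^esub> \<one>\<^bsub>R\<^esub> \<zero>\<^bsub>R\<^esub>"


section \<open>The truncated polynomial ring \<open>A\<^sub>n = K[x]/\<langle>x\<^sup>n\<rangle>\<close> and its involution\<close>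

definition poly_X :: "('a, 'm) ring_scheme \<Rightarrow> nat \<Rightarrow> 'a" where
  "poly_X K = up_ring.monom (UP K) \<one>\<^bsub>K\<^esub> 1"

definition trunc_ring :: "('a, 'm) ring_scheme \<Rightarrow> nat \<Rightarrow> (nat \<Rightarrow> 'a) set ring" where
  "trunc_ring K n = UP K Quot (PIdl\<^bsub>UP K\<^esub> (poly_X K [^]\<^bsub>UP K\<^esub> n))"

definition conj_ext :: "('a, 'm) ring_scheme \<Rightarrow> 'a set \<Rightarrow> 'a \<Rightarrow> 'a \<Rightarrow> 'a" where
  "conj_ext K k \<Delta> z =
    (THE z'. \<exists>a\<in>k. \<exists>b\<in>k. z = a \<oplus>\<^bsub>K\<^esub> b \<otimes>\<^bsub>K\<^esub> \<Delta> \<and> z' = a \<ominus>\<^bsub>K\<^esub> b \<otimes>\<^bsub>K\<^esub> \<Delta>)"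

definition poly_star :: "('a, 'm) ring_scheme \<Rightarrow> 'a set \<Rightarrow> 'a \<Rightarrow> (nat \<Rightarrow> 'a) \<Rightarrow> (nat \<Rightarrow> 'a)" where
  "poly_star K k \<Delta> p =
    (\<lambda>i. (\<ominus>\<^bsub>K\<^esub> \<one>\<^bsub>K\<^esub>) [^]\<^bsub>K\<^esub> i \<otimes>\<^bsub>K\<^esub> conj_ext K k \<Delta> (up_ring.coeff (UP K) p i))"

text \<open>
  \<open>poly_star\<close> is an automorphism of \<open>K[x]\<close> mapping \<open>\<langle>x\<^sup>n\<rangle>\<close> onto itself, so the image
  of the residue class of \<open>p\<close> is the residue class of \<open>poly_star p\<close>.
\<close>

definition trunc_star ::
    "('a, 'm) ring_scheme \<Rightarrow> 'a set \<Rightarrow> 'a \<Rightarrow> (nat \<Rightarrow> 'a) set \<Rightarrow> (nat \<Rightarrow> 'a) set" where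
  "trunc_star K k \<Delta> c = poly_star K k \<Delta> ` c"

end

theory Submission
  imports Defs "HOL-Analysis.Cartesian_Space"
begin

text \<open>
  Since \<open>*\<close> commutes with reduction modulo \<open>x\<close>, the ring \<open>A\<^sub>n\<close> is a commutative local ring with
  involution that contains a skew-symmetric unit, namely \<open>\<Delta>\<close>; the presentation holds over every such ring.
  Let \<open>B\<close> be the set of the products \<open>h\<^sub>t u\<^sub>x w u\<^sub>y\<close>. The relations alone show that \<open>B \<union> B w\<close> is
  stable under right multiplication by the generators, so it exhausts the presented group. The only
  case that is not a plain commutation is \<open>w u\<^sub>b w u\<^sub>a\<close> with \<open>b\<close> a nonunit: for \<open>a\<close> a unit the last
  relation applies twice, and any other \<open>a\<close> is the sum of the units \<open>\<Delta>\<close> and \<open>a - \<Delta>\<close>. On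
  \<open>B \<union> B w\<close> the matrix entries show that only the identity maps to the identity matrix. For
  surjectivity, a matrix whose lower left entry is a unit lies in the image of \<open>B\<close>, and every other
  matrix gets such an entry after multiplication by \<open>w u\<^sub>\<Delta> w\<close>, its upper left entry being a unit.
\<close>

section \<open>Homomorphisms out of a presented group\<close>

definition word_eval :: "('b, 'm) monoid_scheme \<Rightarrow> ('g \<Rightarrow> 'b) \<Rightarrow> 'g word \<Rightarrow> 'b" where
  "word_eval G f w =
    foldr (\<lambda>(x, b) y. (if b then f x else inv\<^bsub>G\<^esub> f x) \<otimes>\<^bsub>G\<^esub> y) w \<one>\<^bsub>G\<^esub>"

lemma word_eval_Nil [simp]: "word_eval G f [] = \<one>\<^bsub>G\<^esub>"
  by (simp add: word_eval_def)

lemma word_eval_Cons [simp]: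
  "word_eval G f ((x, b) # w) = (if b then f x else inv\<^bsub>G\<^esub> f x) \<otimes>\<^bsub>G\<^esub> word_eval G f w"
  by (simp add: word_eval_def)

context group
begin

lemma word_eval_closed:
  "f ` S \<subseteq> carrier G \<Longrightarrow> w \<in> words S \<Longrightarrow> word_eval G f w \<in> carrier G"
  by (induction w) auto

lemma word_eval_append:
  "f ` S \<subseteq> carrier G \<Longrightarrow> v \<in> words S \<Longrightarrow> w \<in> words S \<Longrightarrow>
    word_eval G f (v @ w) = word_eval G f v \<otimes> word_eval G f w"
proof (induction v)
  case Nil
  then show ?case using word_eval_closed[of f S w] by simp
next
  case (Cons a v)
  obtain x b where a: "a = (x, b)" by (cases a)
  show ?case
    using Cons a word_eval_closed[OF Cons.prems(1)] by (auto simp: m_assoc)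
qed

lemma word_eval_cong:
  "word_eq S v w \<Longrightarrow> f ` S \<subseteq> carrier G \<Longrightarrow> word_eval G f v = word_eval G f w"
proof (induction rule: word_eq.induct)
  case (cancel u v x b)
  have [simp]: "f x \<in> carrier G" "word_eval G f v \<in> carrier G"
    using cancel word_eval_closed by auto
  have "word_eval G f ([(x, b), (x, \<not> b)] @ v) = word_eval G f v"
    by (simp add: m_assoc[symmetric])
  then show ?case
    using cancel word_eval_append[of f S] by simp
qed simp_all

text \<open>An element of the free group is a class of words, so the homomorphism evaluates an
  arbitrarily chosen representative; by \<open>word_eval_cong\<close> the value does not depend on
  the choice.\<close>

lemma free_group_universal:
  assumes "f ` S \<subseteq> carrier G"
  obtains \<psi> where "\<psi> \<in> hom (free_group S) G" "\<And>x. x \<in> S \<Longrightarrow> \<psi> (free_gen S x) = f x"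
proof
  define \<psi> where "\<psi> = (\<lambda>C. word_eval G f (SOME w. w \<in> C))"
  have \<psi>: "\<psi> (word_rel S `` {w}) = word_eval G f w" if "w \<in> words S" for w
  proof -
    have "w \<in> word_rel S `` {w}"
      using that by (simp add: word_rel_def word_eq.refl)
    then have "(SOME v. v \<in> word_rel S `` {w}) \<in> word_rel S `` {w}"
      by (rule someI)
    then show ?thesis
      using word_eval_cong[OF _ assms] by (force simp: \<psi>_def word_rel_def)
  qed
  show "\<psi> \<in> hom (free_group S) G"
  proof (rule homI)
    fix C assume "C \<in> carrier (free_group S)"
    then obtain v where v: "v \<in> words S" "C = word_rel S `` {v}"
      by (auto simp: free_group_def quotient_def)
    then show "\<psi> C \<in> carrier G"
      using assms by (simp add: \<psi> word_eval_closed)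
    fix D assume "D \<in> carrier (free_group S)"
    then obtain w where w: "w \<in> words S" "D = word_rel S `` {w}"
      by (auto simp: free_group_def quotient_def)
    show "\<psi> (C \<otimes>\<^bsub>free_group S\<^esub> D) = \<psi> C \<otimes> \<psi> D"
      using v w assms by (simp add: free_group_mult_class \<psi> word_eval_append)
  qed
  show "\<psi> (free_gen S x) = f x" if "x \<in> S" for x
  proof -
    have "f x \<in> carrier G" using assms that by auto
    then show ?thesis using that by (simp add: free_gen_def \<psi>)
  qed
qed

end

section \<open>Generators and universal property of a presented group\<close>

text \<open>The class of a word is the product of the classes of its letters, and a letter marked
  \<open>False\<close> gives the inverse of a generator because the two-letter word cancels.\<close>

lemma generate_free_gen:
  "generate (free_group S) (free_gen S ` S) = carrier (free_group S)"
proof -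
  interpret F: group "free_group S" by (rule group_free_group)
  let ?G = "generate (free_group S) (free_gen S ` S)"
  have gens: "free_gen S ` S \<subseteq> carrier (free_group S)"
    using free_gen_closed by auto
  have letter: "word_rel S `` {[(x, b)]} \<in> ?G" if "x \<in> S" for x b
  proof (cases b)
    case True
    then show ?thesis
      using that by (auto simp: free_gen_def intro: generate.incl)
  next
    case False
    let ?i = "word_rel S `` {[(x, False)]}"
    have "word_eq S ([] @ [(x, False), (x, \<not> False)] @ []) ([] @ [])"
      using that by (intro word_eq.cancel) auto
    then have "word_rel S `` {[(x, False), (x, True)]} = word_rel S `` {[]}"
      by (intro equiv_class_eq[OF equiv_word_rel]) (simp add: word_rel_def)
    then have "?i \<otimes>\<^bsub>free_group S\<^esub> free_gen S x = \<one>\<^bsub>free_group S\<^esub>"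
      using that by (simp add: free_gen_def free_group_mult_class)
        (simp add: free_group_def)
    moreover have "?i \<in> carrier (free_group S)"
      using that by (auto simp: free_group_def intro!: quotientI)
    ultimately have "?i = inv\<^bsub>free_group S\<^esub> (free_gen S x)"
      using that free_gen_closed F.inv_equality by metis
    then show ?thesis
      using that False by (auto intro: generate.inv)
  qed
  have "word_rel S `` {w} \<in> ?G" if "w \<in> words S" for w
    using that
  proof (induction w)
    case Nil
    have "\<one>\<^bsub>free_group S\<^esub> \<in> ?G" by (rule generate.one)
    then show ?case by (simp add: free_group_def)
  next
    case (Cons a w)
    obtain x b where a: "a = (x, b)" by (cases a)
    have "word_rel S `` {a # w} =
        word_rel S `` {[(x, b)]} \<otimes>\<^bsub>free_group S\<^esub> word_rel S `` {w}"
      using Cons.prems a by (simp add: free_group_mult_class)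
    then show ?case
      using Cons a letter by (auto intro: generate.eng)
  qed
  then have "carrier (free_group S) \<subseteq> ?G"
    by (auto simp: free_group_def quotient_def)
  then show ?thesis
    using F.generate_incl[OF gens] by auto
qed

lemma relator_subgroup_normal:
  assumes "R \<subseteq> carrier (free_group S) \<times> carrier (free_group S)"
  shows "relator_subgroup S R \<lhd> free_group S"
proof -
  interpret F: group "free_group S" by (rule group_free_group)
  show ?thesis
    unfolding relator_subgroup_def
    using assms by (intro F.normal_closure_normal) auto
qed

lemma presented_proj_hom:
  assumes "R \<subseteq> carrier (free_group S) \<times> carrier (free_group S)"
  shows "(\<lambda>y. relator_subgroup S R #>\<^bsub>free_group S\<^esub> y) \<in> hom (free_group S) (presented_group S R)"
  unfolding presented_group_def
  by (rule normal.r_coset_hom_Mod[OF relator_subgroup_normal[OF assms]])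

text \<open>The relator of the pair is its own conjugate by the identity, hence lies in the normal
  closure, so both sides have the same coset.\<close>

lemma presented_proj_rel:
  assumes R: "R \<subseteq> carrier (free_group S) \<times> carrier (free_group S)" and lr: "(l, r) \<in> R"
  shows "relator_subgroup S R #>\<^bsub>free_group S\<^esub> l = relator_subgroup S R #>\<^bsub>free_group S\<^esub> r"
proof -
  interpret F: group "free_group S" by (rule group_free_group)
  interpret N: normal "relator_subgroup S R" "free_group S"
    by (rule relator_subgroup_normal[OF R])
  have carr: "l \<in> carrier (free_group S)" "r \<in> carrier (free_group S)"
    using R lr by auto
  let ?x = "l \<otimes>\<^bsub>free_group S\<^esub> inv\<^bsub>free_group S\<^esub> r"
  have "?x = \<one>\<^bsub>free_group S\<^esub> \<otimes>\<^bsub>free_group S\<^esub> ?x \<otimes>\<^bsub>free_group S\<^esub> inv\<^bsub>free_group S\<^esub> \<one>\<^bsub>free_group S\<^esub>"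
    using carr by simp
  then have "?x \<in> relator_subgroup S R"
    unfolding relator_subgroup_def normal_closure_def using lr
    by (intro generate.incl) blast
  then show ?thesis
    using carr F.repr_independence N.subgroup_axioms F.group_axioms
    by (metis N.rcos_module_rev)
qed

text \<open>The projection is onto and carries generators to generators. This is what later allows
  normal forms to be checked on generators only.\<close>

lemma generate_presented_gen:
  assumes R: "R \<subseteq> carrier (free_group S) \<times> carrier (free_group S)"
  shows "generate (presented_group S R) (presented_gen S R ` S) = carrier (presented_group S R)"
proof -
  interpret F: group "free_group S" by (rule group_free_group)
  interpret P: group "presented_group S R" by (rule group_presented_group[OF R])
  let ?\<pi> = "\<lambda>y. relator_subgroup S R #>\<^bsub>free_group S\<^esub> y"
  interpret \<pi>: group_hom "free_group S" "presented_group S R" ?\<pi>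
    using presented_proj_hom[OF R] by unfold_locales
  have "free_gen S ` S \<subseteq> carrier (free_group S)"
    using free_gen_closed by auto
  from \<pi>.generate_img[OF this]
  have "generate (presented_group S R) (?\<pi> ` free_gen S ` S) = ?\<pi> ` carrier (free_group S)"
    by (simp add: generate_free_gen)
  moreover have "?\<pi> ` carrier (free_group S) = carrier (presented_group S R)"
    by (simp add: presented_group_def carrier_FactGroup)
  ultimately show ?thesis
    by (simp add: image_image presented_gen_def)
qed

text \<open>The kernel of \<open>\<psi>\<close> is normal and contains every relator, hence all
  conjugates of relators and the subgroup they generate, so \<open>\<psi>\<close> factors through
  the quotient.\<close>

lemma presented_group_universal:
  assumes R: "R \<subseteq> carrier (free_group S) \<times> carrier (free_group S)"
    and \<psi>: "group_hom (free_group S) G \<psi>"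
    and rel: "\<And>l r. (l, r) \<in> R \<Longrightarrow> \<psi> l = \<psi> r"
  obtains \<phi> where "\<phi> \<in> hom (presented_group S R) G"
    "\<And>x. x \<in> S \<Longrightarrow> \<phi> (presented_gen S R x) = \<psi> (free_gen S x)"
proof -
  interpret \<psi>: group_hom "free_group S" G \<psi> by fact
  interpret K: normal "kernel (free_group S) G \<psi>" "free_group S"
    by (rule \<psi>.normal_kernel)
  have "{g \<otimes>\<^bsub>free_group S\<^esub> r \<otimes>\<^bsub>free_group S\<^esub> inv\<^bsub>free_group S\<^esub> g | g r.
      g \<in> carrier (free_group S) \<and>
      r \<in> {l \<otimes>\<^bsub>free_group S\<^esub> inv\<^bsub>free_group S\<^esub> r | l r. (l, r) \<in> R}}
      \<subseteq> kernel (free_group S) G \<psi>"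
  proof clarify
    fix g l r assume *: "g \<in> carrier (free_group S)" "(l, r) \<in> R"
    then have "l \<in> carrier (free_group S)" "r \<in> carrier (free_group S)"
      using R by auto
    moreover from this have "\<psi> (l \<otimes>\<^bsub>free_group S\<^esub> inv\<^bsub>free_group S\<^esub> r) = \<one>\<^bsub>G\<^esub>"
      by (metis rel[OF *(2)] \<psi>.G.inv_closed \<psi>.hom_closed \<psi>.hom_inv \<psi>.hom_mult \<psi>.H.r_inv)
    ultimately have "l \<otimes>\<^bsub>free_group S\<^esub> inv\<^bsub>free_group S\<^esub> r \<in> kernel (free_group S) G \<psi>"
      unfolding kernel_def by (intro CollectI conjI \<psi>.G.m_closed \<psi>.G.inv_closed)
    then show "g \<otimes>\<^bsub>free_group S\<^esub> (l \<otimes>\<^bsub>free_group S\<^esub> inv\<^bsub>free_group S\<^esub> r) \<otimes>\<^bsub>free_group S\<^esub>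
        inv\<^bsub>free_group S\<^esub> g \<in> kernel (free_group S) G \<psi>"
      using *(1) by (rule K.inv_op_closed2[rotated])
  qed
  then have sub: "relator_subgroup S R \<subseteq> kernel (free_group S) G \<psi>"
    unfolding relator_subgroup_def normal_closure_def
    by (rule \<psi>.G.generate_subgroup_incl[OF _ K.subgroup_axioms])
  show thesis
  proof (rule \<psi>.FactGroup_universal_kernel[OF relator_subgroup_normal[OF R] sub])
    fix \<phi>
    assume "\<phi> \<in> hom (free_group S Mod relator_subgroup S R) G"
      "\<And>x. x \<in> carrier (free_group S) \<Longrightarrow>
        \<phi> (relator_subgroup S R #>\<^bsub>free_group S\<^esub> x) = \<psi> x"
    then show thesis
      by (intro that[of \<phi>])
        (simp_all add: presented_group_def presented_gen_def free_gen_closed)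
  qed
qed

section \<open>The group of a local ring with involution\<close>

lemma mat2_nth [simp]:
  "mat2 a b c d $ 1 $ 1 = a" "mat2 a b c d $ 1 $ 2 = b"
  "mat2 a b c d $ 2 $ 1 = c" "mat2 a b c d $ 2 $ 2 = d"
  by (simp_all add: mat2_def)

lemma mat2_eq_iff [simp]:
  "mat2 a b c d = mat2 a' b' c' d' \<longleftrightarrow> a = a' \<and> b = b' \<and> c = c' \<and> d = d'"
  by (auto simp: vec_eq_iff forall_2)

lemma mat2_cases: obtains a b c d where "g = mat2 a b c d"
proof
  show "g = mat2 (g $ 1 $ 1) (g $ 1 $ 2) (g $ 2 $ 1) (g $ 2 $ 2)"
    by (simp add: vec_eq_iff forall_2)
qed

lemma mat_star_mat2 [simp]: "mat_star s (mat2 a b c d) = mat2 (s a) (s c) (s b) (s d)"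
  by (simp add: mat_star_def vec_eq_iff forall_2)

lemma (in ring) mat_mult_mat2 [simp]:
  assumes "a \<in> carrier R" "b \<in> carrier R" "c \<in> carrier R" "d \<in> carrier R"
    "a' \<in> carrier R" "b' \<in> carrier R" "c' \<in> carrier R" "d' \<in> carrier R"
  shows "mat_mult R (mat2 a b c d) (mat2 a' b' c' d') =
    mat2 (a \<otimes> a' \<oplus> b \<otimes> c') (a \<otimes> b' \<oplus> b \<otimes> d') (c \<otimes> a' \<oplus> d \<otimes> c') (c \<otimes> b' \<oplus> d \<otimes> d')"
proof -
  have "(\<Oplus>l\<in>(UNIV::2 set). f l) = f 1 \<oplus> f 2" if "f 1 \<in> carrier R" "f 2 \<in> carrier R" for f
    using that by (simp add: UNIV_2 Pi_def)
  then show ?thesis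
    using assms by (simp add: mat_mult_def vec_eq_iff forall_2)
qed

lemma (in comm_monoid) inv_mult_Units:
  assumes "s \<in> Units G" "t \<in> Units G"
  shows "inv (s \<otimes> t) = inv s \<otimes> inv t"
proof (rule comm_inv_char)
  have "s \<otimes> t \<otimes> (inv s \<otimes> inv t) = (s \<otimes> inv s) \<otimes> (t \<otimes> inv t)"
    using assms by (simp add: m_ac Units_closed)
  then show "s \<otimes> t \<otimes> (inv s \<otimes> inv t) = \<one>"
    using assms by simp
qed (use assms in auto)

lemma (in ring) minus_Units [simp]: "t \<in> Units R \<Longrightarrow> \<ominus> t \<in> Units R"
  using Units_m_closed[OF Units_minus_one_closed] by (metis Units_closed l_minus l_one one_closed)

lemma (in ring) inv_minus:
  assumes "t \<in> Units R"
  shows "inv (\<ominus> t) = \<ominus> (inv t)"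
  by (rule inv_unique'[symmetric]) (use assms in \<open>simp_all add: l_minus r_minus Units_closed\<close>)

section \<open>Commutative rings with involution and their skew elements\<close>

text \<open>Over a commutative ring an anti-homomorphism is the same as a homomorphism, so the
  involution can be treated as a ring homomorphism.\<close>

locale involution_ring = cring R for R (structure) +
  fixes star :: "'a \<Rightarrow> 'a"
  assumes star_hom: "star \<in> ring_hom R R"
    and star_star [simp]: "a \<in> carrier R \<Longrightarrow> star (star a) = a"
begin

sublocale star: ring_hom_cring R R star
  using star_hom by unfold_locales

lemma star_Units [simp]: "t \<in> Units R \<Longrightarrow> star t \<in> Units R"
  by (metis Units_closed Units_inv_closed Units_l_inv comm_inv_char star.hom_closed
      star.hom_mult star.hom_one unit_factor Units_one_closed Units_r_inv)

lemma star_inv: "t \<in> Units R \<Longrightarrow> star (inv t) = inv (star t)"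
  by (metis Units_closed Units_inv_closed Units_r_inv comm_inv_char star.hom_closed
      star.hom_mult star.hom_one)

text \<open>The involution of the unit group that conjugation by \<open>w\<close> induces on the
  elements \<open>h t\<close>.\<close>

definition dual :: "'a \<Rightarrow> 'a" where "dual t = inv (star t)"

lemma dual_Units [simp]: "t \<in> Units R \<Longrightarrow> dual t \<in> Units R"
  by (simp add: dual_def)

lemma dual_dual [simp]: "t \<in> Units R \<Longrightarrow> dual (dual t) = t"
  by (simp add: dual_def star_inv Units_closed)

lemma dual_one [simp]: "dual \<one> = \<one>"
  by (simp add: dual_def)

abbreviation "Asym \<equiv> asym_elems R star"

lemma asym_iff: "a \<in> Asym \<longleftrightarrow> a \<in> carrier R \<and> star a = \<ominus> a"
  by (simp add: asym_elems_def)

lemma asym_closed [simp]: "a \<in> Asym \<Longrightarrow> a \<in> carrier R"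
  by (simp add: asym_iff)

lemma asym_zero [simp]: "\<zero> \<in> Asym"
  by (simp add: asym_iff del: asym_closed)

lemma asym_add [simp]: "a \<in> Asym \<Longrightarrow> b \<in> Asym \<Longrightarrow> a \<oplus> b \<in> Asym"
  by (simp add: asym_iff minus_add a_comm del: asym_closed)

lemma asym_minus [simp]: "a \<in> Asym \<Longrightarrow> \<ominus> a \<in> Asym"
  by (simp add: asym_iff del: asym_closed)

lemma asym_inv [simp]: "a \<in> Asym \<Longrightarrow> a \<in> Units R \<Longrightarrow> inv a \<in> Asym"
  by (simp add: asym_iff star_inv inv_minus del: asym_closed)

text \<open>The action of units on skew elements that conjugation by \<open>h t\<close> induces on
  the exponents of \<open>u\<close>.\<close>

definition conjugate :: "'a \<Rightarrow> 'a \<Rightarrow> 'a" where "conjugate t a = t \<otimes> a \<otimes> star t"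

lemma conjugate_asym [simp]: "t \<in> carrier R \<Longrightarrow> a \<in> Asym \<Longrightarrow> conjugate t a \<in> Asym"
  by (simp add: asym_iff conjugate_def l_minus r_minus m_ac del: asym_closed)

lemma conjugate_inv:
  assumes "t \<in> Units R" "a \<in> carrier R"
  shows "conjugate t (conjugate (inv t) a) = a"
proof -
  have "t \<in> carrier R" "inv t \<in> carrier R" "star t \<in> carrier R" "inv (star t) \<in> carrier R"
    using assms by auto
  then have "t \<otimes> (inv t \<otimes> a \<otimes> inv (star t)) \<otimes> star t = (t \<otimes> inv t) \<otimes> (star t \<otimes> inv (star t)) \<otimes> a"
    using assms(2) by algebra
  then have "conjugate t (conjugate (inv t) a) = (t \<otimes> inv t) \<otimes> (star t \<otimes> inv (star t)) \<otimes> a"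
    using assms by (simp add: conjugate_def star_inv)
  then show ?thesis
    using assms by simp
qed

section \<open>The matrix group\<close>

lemma mat2_in_SL:
  "mat2 a b c d \<in> carrier (SL_star1 R star) \<longleftrightarrow>
    a \<in> carrier R \<and> b \<in> carrier R \<and> c \<in> carrier R \<and> d \<in> carrier R \<and>
    star c \<otimes> a \<oplus> star a \<otimes> c = \<zero> \<and> star c \<otimes> b \<oplus> star a \<otimes> d = \<one> \<and>
    star d \<otimes> a \<oplus> star b \<otimes> c = \<one> \<and> star d \<otimes> b \<oplus> star b \<otimes> d = \<zero>"
  by (auto simp: SL_star1_def mat_J_def forall_2)

lemma SL_mult: "x \<otimes>\<^bsub>SL_star1 R star\<^esub> y = mat_mult R x y"
  by (simp add: SL_star1_def)

lemma SL_one: "\<one>\<^bsub>SL_star1 R star\<^esub> = mat2 \<one> \<zero> \<zero> \<one>"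
  by (simp add: SL_star1_def)

text \<open>The left side is an entry of the form for a product of matrices: capitals stand for the
  starred entries of the left factor, \<open>p\<close>, \<open>q\<close> for a starred column and
  \<open>r\<close>, \<open>s\<close> for a column of the right factor. The four brackets on the
  right are the defining expressions of the left factor, with values 1, 1, 0, 0, so only the form of
  the right factor remains.\<close>

lemma hermitian_form_expand:
  assumes "p \<in> carrier R" "q \<in> carrier R" "r \<in> carrier R" "s \<in> carrier R"
    "a \<in> carrier R" "b \<in> carrier R" "c \<in> carrier R" "d \<in> carrier R"
    "A \<in> carrier R" "B \<in> carrier R" "C \<in> carrier R" "D \<in> carrier R"
  shows "(C \<otimes> p \<oplus> D \<otimes> q) \<otimes> (a \<otimes> r \<oplus> b \<otimes> s) \<oplus> (A \<otimes> p \<oplus> B \<otimes> q) \<otimes> (c \<otimes> r \<oplus> d \<otimes> s) =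
    (q \<otimes> r) \<otimes> (D \<otimes> a \<oplus> B \<otimes> c) \<oplus> (p \<otimes> s) \<otimes> (C \<otimes> b \<oplus> A \<otimes> d) \<oplus>
    (p \<otimes> r) \<otimes> (C \<otimes> a \<oplus> A \<otimes> c) \<oplus> (q \<otimes> s) \<otimes> (D \<otimes> b \<oplus> B \<otimes> d)"
  using assms by algebra

text \<open>The matrix in the conclusion is J times the star of g times J, which is a left inverse
  of g. That it belongs to the group amounts to the equations for the rows of g, while the
  hypothesis gives those for the columns; they are derived by explicit identities.\<close>

lemma SL_adjoint_closed:
  assumes "mat2 a b c d \<in> carrier (SL_star1 R star)"
  shows "mat2 (star d) (star b) (star c) (star a) \<in> carrier (SL_star1 R star)"
proof -
  from assms have carr [simp]: "a \<in> carrier R" "b \<in> carrier R" "c \<in> carrier R" "d \<in> carrier R"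
    and E: "star c \<otimes> a \<oplus> star a \<otimes> c = \<zero>" "star c \<otimes> b \<oplus> star a \<otimes> d = \<one>"
      "star d \<otimes> a \<oplus> star b \<otimes> c = \<one>" "star d \<otimes> b \<oplus> star b \<otimes> d = \<zero>"
    by (auto simp: mat2_in_SL)
  have [simp]: "star a \<in> carrier R" "star b \<in> carrier R" "star c \<in> carrier R" "star d \<in> carrier R"
    by simp_all
  have aux: "c \<otimes> star d \<oplus> d \<otimes> star c = \<zero>"
  proof -
    \<comment> \<open>Weighting the two equations of value 1 by \<open>d \<otimes> star c\<close>
      and \<open>c \<otimes> star d\<close> yields a combination of the two equations of value
      0.\<close>
    have "d \<otimes> star c \<otimes> (star d \<otimes> a \<oplus> star b \<otimes> c) \<oplus> c \<otimes> star d \<otimes> (star c \<otimes> b \<oplus> star a \<otimes> d)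
      = d \<otimes> star d \<otimes> (star c \<otimes> a \<oplus> star a \<otimes> c) \<oplus> c \<otimes> star c \<otimes> (star d \<otimes> b \<oplus> star b \<otimes> d)"
      by (simp add: l_distr r_distr a_ac m_ac)
    then show ?thesis by (simp add: E a_comm)
  qed
  have aux': "a \<otimes> star b \<oplus> b \<otimes> star a = \<zero>"
  proof -
    have "a \<otimes> star b \<otimes> (star c \<otimes> b \<oplus> star a \<otimes> d) \<oplus> b \<otimes> star a \<otimes> (star d \<otimes> a \<oplus> star b \<otimes> c)
      = a \<otimes> star a \<otimes> (star d \<otimes> b \<oplus> star b \<otimes> d) \<oplus> b \<otimes> star b \<otimes> (star c \<otimes> a \<oplus> star a \<otimes> c)"
      by (simp add: l_distr r_distr a_ac m_ac)
    then show ?thesis by (simp add: E)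
  qed
  \<comment> \<open>Both \<open>d\<close> and \<open>a\<close> equal their own stars times the
    determinant, so \<open>a \<otimes> star d\<close> and \<open>star a \<otimes> d\<close> are both
    the determinant times \<open>star a \<otimes> star d\<close>. This exchanges the two equations
    of value 1.\<close>
  have d: "d = star d \<otimes> (a \<otimes> d \<ominus> b \<otimes> c)"
  proof -
    have "d \<otimes> (star d \<otimes> a \<oplus> star b \<otimes> c) \<ominus> c \<otimes> (star d \<otimes> b \<oplus> star b \<otimes> d) =
        star d \<otimes> (a \<otimes> d \<ominus> b \<otimes> c)"
      using \<open>star b \<in> carrier R\<close> \<open>star d \<in> carrier R\<close> carr by algebra
    then show ?thesis by (simp add: E a_minus_def)
  qed
  have a: "a = star a \<otimes> (a \<otimes> d \<ominus> b \<otimes> c)"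
  proof -
    have "a \<otimes> (star c \<otimes> b \<oplus> star a \<otimes> d) \<ominus> b \<otimes> (star c \<otimes> a \<oplus> star a \<otimes> c) =
        star a \<otimes> (a \<otimes> d \<ominus> b \<otimes> c)"
      using \<open>star a \<in> carrier R\<close> \<open>star c \<in> carrier R\<close> carr by algebra
    then show ?thesis by (simp add: E a_minus_def)
  qed
  have ad: "a \<otimes> star d = star a \<otimes> d"
    using a d \<open>star a \<in> carrier R\<close> \<open>star d \<in> carrier R\<close> carr
    by (metis m_assoc m_comm minus_closed m_closed)
  have "star a \<otimes> d \<oplus> b \<otimes> star c = \<one>" "b \<otimes> star d \<oplus> d \<otimes> star b = \<zero>"
    using E by (simp_all add: m_comm a_comm)
  moreover have "c \<otimes> star b \<oplus> d \<otimes> star a = \<one>"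
    using E(3) ad by (simp add: m_comm a_comm)
  ultimately show ?thesis
    using aux aux' ad by (simp add: mat2_in_SL m_comm a_comm)
qed

lemma SL_group: "group (SL_star1 R star)"
proof (rule groupI)
  show "\<one>\<^bsub>SL_star1 R star\<^esub> \<in> carrier (SL_star1 R star)"
    by (simp add: SL_one mat2_in_SL)
  fix x assume x: "x \<in> carrier (SL_star1 R star)"
  obtain a b c d where x_eq: "x = mat2 a b c d" by (rule mat2_cases)
  note X = x[unfolded x_eq mat2_in_SL]
  show "\<one>\<^bsub>SL_star1 R star\<^esub> \<otimes>\<^bsub>SL_star1 R star\<^esub> x = x"
    using X by (simp add: SL_one SL_mult x_eq)
  show "\<exists>y\<in>carrier (SL_star1 R star). y \<otimes>\<^bsub>SL_star1 R star\<^esub> x = \<one>\<^bsub>SL_star1 R star\<^esub>"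
  proof
    show "mat2 (star d) (star b) (star c) (star a) \<in> carrier (SL_star1 R star)"
      using SL_adjoint_closed x x_eq by simp
    show "mat2 (star d) (star b) (star c) (star a) \<otimes>\<^bsub>SL_star1 R star\<^esub> x = \<one>\<^bsub>SL_star1 R star\<^esub>"
      using X by (simp add: SL_one SL_mult x_eq)
  qed
  fix y assume y: "y \<in> carrier (SL_star1 R star)"
  obtain p q r s where y_eq: "y = mat2 p q r s" by (rule mat2_cases)
  note Y = y[unfolded y_eq mat2_in_SL]
  have "star p \<in> carrier R" "star q \<in> carrier R" "star r \<in> carrier R" "star s \<in> carrier R"
    "star a \<in> carrier R" "star b \<in> carrier R" "star c \<in> carrier R" "star d \<in> carrier R"
    using X Y by simp_all
  then show "x \<otimes>\<^bsub>SL_star1 R star\<^esub> y \<in> carrier (SL_star1 R star)"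
    using X Y by (simp add: SL_mult x_eq y_eq mat2_in_SL hermitian_form_expand)
  fix z assume z: "z \<in> carrier (SL_star1 R star)"
  obtain t u v w where z_eq: "z = mat2 t u v w" by (rule mat2_cases)
  note Z = z[unfolded z_eq mat2_in_SL]
  have assoc: "(a \<otimes> p \<oplus> b \<otimes> r) \<otimes> t \<oplus> (a \<otimes> q \<oplus> b \<otimes> s) \<otimes> v =
      a \<otimes> (p \<otimes> t \<oplus> q \<otimes> v) \<oplus> b \<otimes> (r \<otimes> t \<oplus> s \<otimes> v)"
    if "a \<in> carrier R" "b \<in> carrier R" "p \<in> carrier R" "q \<in> carrier R" "r \<in> carrier R"
      "s \<in> carrier R" "t \<in> carrier R" "v \<in> carrier R" for a b p q r s t v
    using that by algebra
  show "x \<otimes>\<^bsub>SL_star1 R star\<^esub> y \<otimes>\<^bsub>SL_star1 R star\<^esub> z = x \<otimes>\<^bsub>SL_star1 R star\<^esub> (y \<otimes>\<^bsub>SL_star1 R star\<^esub> z)"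
    using X Y Z by (simp add: SL_mult x_eq y_eq z_eq assoc)
qed

end

section \<open>Local rings with a skew unit\<close>

text \<open>Locality is stated elementwise, as closure of the nonunits under addition, so that no
  maximal ideal has to be mentioned.\<close>

locale local_involution_ring = involution_ring R star for R (structure) and star +
  fixes \<delta> :: 'a
  assumes one_not_zero: "\<one> \<noteq> \<zero>"
    and local_ring: "a \<in> carrier R \<Longrightarrow> b \<in> carrier R \<Longrightarrow> a \<oplus> b \<in> Units R \<Longrightarrow>
      a \<in> Units R \<or> b \<in> Units R"
    and \<delta>: "\<delta> \<in> Units R" "\<delta> \<in> Asym"
begin

lemma unit_add_nonunit:
  assumes "a \<in> Units R" "b \<in> carrier R" "b \<notin> Units R"
  shows "a \<oplus> b \<in> Units R"
proof -
  have "a \<oplus> b \<oplus> \<ominus> b = a"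
    using assms by (simp add: a_assoc r_neg Units_closed)
  then have "a \<oplus> b \<in> Units R \<or> \<ominus> b \<in> Units R"
    using assms local_ring[of "a \<oplus> b" "\<ominus> b"] by auto
  moreover have "\<ominus> b \<notin> Units R"
    using assms minus_Units[of "\<ominus> b"] by auto
  ultimately show ?thesis by blast
qed

lemma bruhat_matrix_closed:
  assumes "x \<in> bruhat_gens R star"
  shows "bruhat_matrix R star x \<in> carrier (SL_star1 R star)"
  using assms by (auto simp: bruhat_gens_def mat2_in_SL asym_elems_def star_inv Units_closed l_neg r_neg simp del: asym_closed)

end

section \<open>Normal forms modulo the relations\<close>

text \<open>An arbitrary group with elements that satisfy the relations. Two groups are of this
  kind: the matrix group, which gives the homomorphism, and the presented group, in which the normal
  forms are derived.\<close>

locale bruhat_relations =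
  local_involution_ring R star \<delta> + P: group P
  for R (structure) and star and \<delta> and P +
  fixes h u :: "'a \<Rightarrow> 'c" and w :: 'c
  assumes h_closed [simp]: "t \<in> Units R \<Longrightarrow> h t \<in> carrier P"
    and u_closed [simp]: "a \<in> Asym \<Longrightarrow> u a \<in> carrier P"
    and w_closed [simp]: "w \<in> carrier P"
    and hh: "s \<in> Units R \<Longrightarrow> t \<in> Units R \<Longrightarrow> h s \<otimes>\<^bsub>P\<^esub> h t = h (s \<otimes> t)"
    and uu: "a \<in> Asym \<Longrightarrow> b \<in> Asym \<Longrightarrow> u a \<otimes>\<^bsub>P\<^esub> u b = u (a \<oplus> b)"
    and hu: "t \<in> Units R \<Longrightarrow> a \<in> Asym \<Longrightarrow> h t \<otimes>\<^bsub>P\<^esub> u a = u (t \<otimes> a \<otimes> star t) \<otimes>\<^bsub>P\<^esub> h t"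
    and ww: "w \<otimes>\<^bsub>P\<^esub> w = \<one>\<^bsub>P\<^esub>"
    and hw: "t \<in> Units R \<Longrightarrow> h t \<otimes>\<^bsub>P\<^esub> w = w \<otimes>\<^bsub>P\<^esub> h (inv (star t))"
    and wu3: "t \<in> Units R \<Longrightarrow> t \<in> Asym \<Longrightarrow>
      w \<otimes>\<^bsub>P\<^esub> u (inv t) \<otimes>\<^bsub>P\<^esub> w \<otimes>\<^bsub>P\<^esub> u (\<ominus> t) \<otimes>\<^bsub>P\<^esub> w \<otimes>\<^bsub>P\<^esub> u (inv t) = h (\<ominus> t)"
begin

abbreviation pmult (infixr "\<diamondop>" 70) where "x \<diamondop> y \<equiv> x \<otimes>\<^bsub>P\<^esub> y"

lemma idempotent_one: "x \<in> carrier P \<Longrightarrow> x \<diamondop> x = x \<Longrightarrow> x = \<one>\<^bsub>P\<^esub>"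
  using P.l_cancel_one by blast

lemma h_one [simp]: "h \<one> = \<one>\<^bsub>P\<^esub>"
  by (rule idempotent_one) (simp_all add: hh)

lemma u_zero [simp]: "u \<zero> = \<one>\<^bsub>P\<^esub>"
  by (rule idempotent_one) (simp_all add: uu)

lemma inv_h: "t \<in> Units R \<Longrightarrow> inv\<^bsub>P\<^esub> (h t) = h (inv t)"
  by (rule P.inv_equality) (simp_all add: hh)

lemma inv_u: "a \<in> Asym \<Longrightarrow> inv\<^bsub>P\<^esub> (u a) = u (\<ominus> a)"
  by (rule P.inv_equality) (simp_all add: uu l_neg)

lemma inv_w: "inv\<^bsub>P\<^esub> w = w"
  by (rule P.inv_equality) (simp_all add: ww)

text \<open>Read from left to right, this rule and \<open>wh\<close> move every \<open>h\<close> to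
  the left end of a product.\<close>

lemma uh:
  assumes "t \<in> Units R" "a \<in> Asym"
  shows "u a \<diamondop> h t = h t \<diamondop> u (conjugate (inv t) a)"
  using assms hu[of t "conjugate (inv t) a"] conjugate_inv[of t a]
  by (simp add: conjugate_def[of t] Units_closed)

lemma wh: "t \<in> Units R \<Longrightarrow> w \<diamondop> h t = h (dual t) \<diamondop> w"
  using hw[of "dual t"] by (simp add: dual_def[of "dual t", symmetric])

text \<open>The last relation for \<open>inv a\<close>, multiplied on the right by
  \<open>u (\<ominus> a) \<diamondop> w \<diamondop> u (inv a)\<close>: the tail then cancels by
  \<open>uu\<close> and \<open>ww\<close>. The right side is a normal form, which makes this the key
  reduction.\<close>

lemma wuw:
  assumes "a \<in> Units R" "a \<in> Asym"
  shows "w \<diamondop> u a \<diamondop> w = h (\<ominus> (inv a)) \<diamondop> u (\<ominus> a) \<diamondop> w \<diamondop> u (inv a)"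
proof -
  let ?t = "inv a"
  have [simp]: "?t \<in> Units R" "?t \<in> Asym" "inv ?t = a" "\<ominus> ?t \<in> Asym" "\<ominus> a \<in> Asym"
    using assms by simp_all
  have "w \<diamondop> u a \<diamondop> w \<diamondop> u (\<ominus> ?t) \<diamondop> w \<diamondop> u a = h (\<ominus> ?t)"
    using wu3[of ?t] assms by (simp add: P.m_assoc)
  then have "h (\<ominus> ?t) \<diamondop> u (\<ominus> a) \<diamondop> w \<diamondop> u ?t =
      w \<diamondop> u a \<diamondop> w \<diamondop> u (\<ominus> ?t) \<diamondop> w \<diamondop> (u a \<diamondop> u (\<ominus> a)) \<diamondop> w \<diamondop> u ?t"
    using assms by (simp add: P.m_assoc[symmetric])
  also have "\<dots> = w \<diamondop> u a \<diamondop> w \<diamondop> u (\<ominus> ?t) \<diamondop> (w \<diamondop> w) \<diamondop> u ?t"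
    using assms by (simp add: uu r_neg P.m_assoc)
  also have "\<dots> = w \<diamondop> u a \<diamondop> w \<diamondop> (u (\<ominus> ?t) \<diamondop> u ?t)"
    using assms by (simp add: ww P.m_assoc)
  also have "\<dots> = w \<diamondop> u a \<diamondop> w"
    by (simp add: uu l_neg assms)
  finally show ?thesis by simp
qed

section \<open>The big cell, its translate by \<open>w\<close>, and stability under the
  generators\<close>

text \<open>In the matrix group this is the set of matrices whose lower left entry is a unit, by
  \<open>bruhat_matrix_form\<close> and \<open>SL_bruhat\<close>.\<close>

definition big_cell :: "'c set" where
  "big_cell = {h t \<diamondop> u x \<diamondop> w \<diamondop> u y | t x y. t \<in> Units R \<and> x \<in> Asym \<and> y \<in> Asym}"

definition all_forms :: "'c set" where
  "all_forms = big_cell \<union> {x \<diamondop> w | x. x \<in> big_cell}"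

lemma big_cell_closed: "x \<in> big_cell \<Longrightarrow> x \<in> carrier P"
  by (auto simp: big_cell_def)

lemma big_cellI: "t \<in> Units R \<Longrightarrow> x \<in> Asym \<Longrightarrow> y \<in> Asym \<Longrightarrow> h t \<diamondop> u x \<diamondop> w \<diamondop> u y \<in> big_cell"
  by (auto simp: big_cell_def)

lemma all_forms_closed: "x \<in> all_forms \<Longrightarrow> x \<in> carrier P"
  by (auto simp: all_forms_def big_cell_closed)

lemma h_big_cell:
  assumes "t \<in> Units R" "x \<in> big_cell"
  shows "h t \<diamondop> x \<in> big_cell"
proof -
  obtain s a b where x: "x = h s \<diamondop> u a \<diamondop> w \<diamondop> u b" "s \<in> Units R" "a \<in> Asym" "b \<in> Asym"
    using assms(2) by (auto simp: big_cell_def)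
  have "h t \<diamondop> x = (h t \<diamondop> h s) \<diamondop> u a \<diamondop> w \<diamondop> u b"
    using x assms(1) by (simp add: P.m_assoc)
  then show ?thesis
    using x assms(1) by (auto simp: hh intro!: big_cellI)
qed

lemma u_big_cell:
  assumes "y \<in> Asym" "x \<in> big_cell"
  shows "u y \<diamondop> x \<in> big_cell"
proof -
  obtain s a b where x: "x = h s \<diamondop> u a \<diamondop> w \<diamondop> u b" "s \<in> Units R" "a \<in> Asym" "b \<in> Asym"
    using assms(2) by (auto simp: big_cell_def)
  let ?c = "conjugate (inv s) y"
  have c: "?c \<in> Asym"
    using x assms(1) by (simp add: Units_closed)
  have "u y \<diamondop> x = (u y \<diamondop> h s) \<diamondop> u a \<diamondop> w \<diamondop> u b"
    using x assms(1) by (simp add: P.m_assoc)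
  also have "\<dots> = h s \<diamondop> (u ?c \<diamondop> u a) \<diamondop> w \<diamondop> u b"
    using x assms(1) c by (simp add: uh P.m_assoc)
  finally show ?thesis
    using x c by (auto simp: uu intro!: big_cellI)
qed

lemma big_cell_u:
  assumes "x \<in> big_cell" "y \<in> Asym"
  shows "x \<diamondop> u y \<in> big_cell"
proof -
  obtain s a b where x: "x = h s \<diamondop> u a \<diamondop> w \<diamondop> u b" "s \<in> Units R" "a \<in> Asym" "b \<in> Asym"
    using assms(1) by (auto simp: big_cell_def)
  have "x \<diamondop> u y = h s \<diamondop> u a \<diamondop> w \<diamondop> (u b \<diamondop> u y)"
    using x assms(2) by (simp add: P.m_assoc)
  then show ?thesis
    using x assms(2) by (auto simp: uu intro!: big_cellI)
qed

lemma big_cell_h: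
  assumes "x \<in> big_cell" "t \<in> Units R"
  shows "x \<diamondop> h t \<in> big_cell"
proof -
  obtain s a b where x: "x = h s \<diamondop> u a \<diamondop> w \<diamondop> u b" "s \<in> Units R" "a \<in> Asym" "b \<in> Asym"
    using assms(1) by (auto simp: big_cell_def)
  let ?b = "conjugate (inv t) b"
  have b: "?b \<in> Asym"
    using x assms by (simp add: Units_closed)
  have "x \<diamondop> h t = h s \<diamondop> u a \<diamondop> w \<diamondop> (u b \<diamondop> h t)"
    using x assms(2) by (simp add: P.m_assoc)
  also have "\<dots> = h s \<diamondop> u a \<diamondop> (w \<diamondop> h t) \<diamondop> u ?b"
    using x b assms(2) by (simp add: uh P.m_assoc)
  also have "\<dots> = h s \<diamondop> u a \<diamondop> h (dual t) \<diamondop> w \<diamondop> u ?b"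
    using x b assms(2) by (simp add: wh P.m_assoc)
  \<comment> \<open>The trivial factor \<open>u \<zero>\<close> completes the bracket to a normal
    form, so that left multiplication by \<open>u a\<close> and \<open>h s\<close> stays in the big
    cell.\<close>
  also have "\<dots> = h s \<diamondop> u a \<diamondop> (h (dual t) \<diamondop> u \<zero> \<diamondop> w \<diamondop> u ?b)"
    using x b assms(2) by simp
  finally show ?thesis
    using x b assms(2) by (metis h_big_cell u_big_cell big_cellI dual_Units asym_zero)
qed

lemma wuw_big_cell:
  assumes "a \<in> Units R" "a \<in> Asym"
  shows "w \<diamondop> u a \<diamondop> w \<in> big_cell"
  using assms by (simp add: wuw big_cellI)

text \<open>If the last exponent \<open>b\<close> is a unit, \<open>wuw\<close> brings
  \<open>w \<diamondop> u b \<diamondop> w\<close> back into the big cell. Hence only nonunits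
  \<open>b\<close> have to be considered in the second case.\<close>

lemma all_forms_cases:
  assumes "x \<in> all_forms"
  obtains (big) "x \<in> big_cell"
  | (small) t a b where "x = h t \<diamondop> u a \<diamondop> w \<diamondop> u b \<diamondop> w" "t \<in> Units R" "a \<in> Asym" "b \<in> Asym" "b \<notin> Units R"
proof -
  from assms consider "x \<in> big_cell" | y where "y \<in> big_cell" "x = y \<diamondop> w"
    by (auto simp: all_forms_def)
  then show thesis
  proof cases
    case 1
    then show thesis by (rule big)
  next
    case 2
    then obtain t a b where *: "x = (h t \<diamondop> u a \<diamondop> w \<diamondop> u b) \<diamondop> w" "t \<in> Units R" "a \<in> Asym" "b \<in> Asym"
      by (auto simp: big_cell_def)
    then have x: "x = h t \<diamondop> u a \<diamondop> w \<diamondop> u b \<diamondop> w"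
      by (simp add: P.m_assoc)
    show thesis
    proof (cases "b \<in> Units R")
      case True
      then have "x \<in> big_cell"
        unfolding x using *(2-4) by (simp add: h_big_cell u_big_cell wuw_big_cell)
      then show thesis by (rule big)
    next
      case False
      then show thesis using small x * by blast
    qed
  qed
qed

lemma all_forms_w:
  assumes "x \<in> all_forms"
  shows "x \<diamondop> w \<in> all_forms"
  using assms unfolding all_forms_def
  by (auto simp: P.m_assoc ww big_cell_closed)

lemma all_forms_h:
  assumes "x \<in> all_forms" "t \<in> Units R"
  shows "x \<diamondop> h t \<in> all_forms"
proof -
  from assms(1) consider "x \<in> big_cell" | y where "y \<in> big_cell" "x = y \<diamondop> w"
    by (auto simp: all_forms_def)
  then show ?thesis
  proof cases
    case 1
    then show ?thesis
      using big_cell_h[OF _ assms(2)] by (simp add: all_forms_def)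
  next
    case 2
    then have "x \<diamondop> h t = (y \<diamondop> h (dual t)) \<diamondop> w"
      using assms(2) by (simp add: wh P.m_assoc big_cell_closed)
    then show ?thesis
      using 2(1) assms(2) big_cell_h[of y "dual t"] by (auto simp: all_forms_def)
  qed
qed

lemma h_all_forms:
  assumes "x \<in> all_forms" "t \<in> Units R"
  shows "h t \<diamondop> x \<in> all_forms"
proof -
  from assms(1) consider "x \<in> big_cell" | y where "y \<in> big_cell" "x = y \<diamondop> w"
    by (auto simp: all_forms_def)
  then show ?thesis
  proof cases
    case 1
    then show ?thesis
      using h_big_cell[OF assms(2)] by (simp add: all_forms_def)
  next
    case 2
    then have "h t \<diamondop> x = (h t \<diamondop> y) \<diamondop> w"
      using assms(2) by (simp add: P.m_assoc big_cell_closed)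
    then show ?thesis
      using h_big_cell[OF assms(2) 2(1)] by (auto simp: all_forms_def)
  qed
qed

lemma u_all_forms:
  assumes "x \<in> all_forms" "a \<in> Asym"
  shows "u a \<diamondop> x \<in> all_forms"
proof -
  from assms(1) consider "x \<in> big_cell" | y where "y \<in> big_cell" "x = y \<diamondop> w"
    by (auto simp: all_forms_def)
  then show ?thesis
  proof cases
    case 1
    then show ?thesis
      using u_big_cell[OF assms(2)] by (simp add: all_forms_def)
  next
    case 2
    then have "u a \<diamondop> x = (u a \<diamondop> y) \<diamondop> w"
      using assms(2) by (simp add: P.m_assoc big_cell_closed)
    then show ?thesis
      using u_big_cell[OF assms(2) 2(1)] by (auto simp: all_forms_def)
  qed
qed

text \<open>
  Expanding \<open>w u\<^sub>a w\<close> turns the middle exponent \<open>b\<close> into the unit \<open>b' - a\<close>, so that the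
  expansion can be applied a second time.
\<close>

lemma all_forms_u_unit:
  assumes "x \<in> all_forms" "a \<in> Units R" "a \<in> Asym"
  shows "x \<diamondop> u a \<in> all_forms"
  using assms(1)
proof (cases rule: all_forms_cases)
  case big
  then show ?thesis
    using big_cell_u assms(3) by (simp add: all_forms_def)
next
  case (small t c b)
  \<comment> \<open>\<open>?t\<close> is the argument of \<open>h\<close> that \<open>wuw\<close>
    produces for \<open>a\<close>, and \<open>?b\<close> is what \<open>b\<close> becomes when this
    \<open>h\<close> is moved past \<open>u b\<close>.\<close>
  let ?t = "\<ominus> (inv a)" let ?b = "conjugate (inv ?t) b"
  let ?e = "?b \<oplus> \<ominus> a"
  have t: "?t \<in> Units R" using assms by simp
  have b: "?b \<in> Asym" using small t by (simp add: Units_closed)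
  have ia: "inv a \<in> Asym" using assms by simp
  \<comment> \<open>Twisting by a unit preserves units, so \<open>?b\<close> is a nonunit like
    \<open>b\<close>, and adding the unit \<open>\<ominus> a\<close> gives a unit.\<close>
  have "conjugate ?t ?b \<notin> Units R"
    using small t conjugate_inv[of ?t b] by simp
  then have "?b \<notin> Units R"
    using t unfolding conjugate_def by auto
  then have e: "?e \<in> Units R" "?e \<in> Asym"
    using unit_add_nonunit[of "\<ominus> a" ?b] assms b by (simp_all add: a_comm)
  \<comment> \<open>The square of \<open>w\<close> is inserted at the right end to create the factor
    \<open>w \<diamondop> u a \<diamondop> w\<close>.\<close>
  have "w \<diamondop> u b \<diamondop> w \<diamondop> u a = w \<diamondop> u b \<diamondop> (w \<diamondop> u a \<diamondop> w) \<diamondop> w"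
    using small assms by (simp add: P.m_assoc ww)
  also have "\<dots> = w \<diamondop> u b \<diamondop> h ?t \<diamondop> u (\<ominus> a) \<diamondop> w \<diamondop> u (inv a) \<diamondop> w"
    using small assms t ia by (simp add: wuw P.m_assoc)
  also have "\<dots> = w \<diamondop> (u b \<diamondop> h ?t) \<diamondop> u (\<ominus> a) \<diamondop> w \<diamondop> u (inv a) \<diamondop> w"
    using small assms t ia by (simp add: P.m_assoc)
  also have "\<dots> = (w \<diamondop> h ?t) \<diamondop> (u ?b \<diamondop> u (\<ominus> a)) \<diamondop> w \<diamondop> u (inv a) \<diamondop> w"
    using small assms t ia b by (simp add: uh P.m_assoc)
  also have "\<dots> = h (dual ?t) \<diamondop> (w \<diamondop> u ?e \<diamondop> w) \<diamondop> u (inv a) \<diamondop> w"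
    using small assms t ia b e by (simp add: uu wh P.m_assoc)
  also have "\<dots> = ((h (dual ?t) \<diamondop> (w \<diamondop> u ?e \<diamondop> w)) \<diamondop> u (inv a)) \<diamondop> w"
    using small assms t ia b e by (simp add: P.m_assoc)
  finally have "w \<diamondop> u b \<diamondop> w \<diamondop> u a \<in> all_forms"
    using h_big_cell[OF dual_Units[OF t] wuw_big_cell[OF e]] ia big_cell_u
    by (auto simp: all_forms_def)
  then have "h t \<diamondop> u c \<diamondop> w \<diamondop> u b \<diamondop> w \<diamondop> u a \<in> all_forms"
    using small by (intro h_all_forms u_all_forms)
  then show ?thesis
    using small assms by (simp add: P.m_assoc)
qed

lemma all_forms_u:
  assumes "x \<in> all_forms" "a \<in> Asym"
  shows "x \<diamondop> u a \<in> all_forms"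
proof (cases "a \<in> Units R")
  case True
  then show ?thesis using all_forms_u_unit assms by blast
next
  case False
  have e: "\<ominus> \<delta> \<oplus> a \<in> Units R"
    using False \<delta> assms by (intro unit_add_nonunit) simp_all
  have "\<delta> \<oplus> (\<ominus> \<delta> \<oplus> a) = a"
    using \<delta> assms by (simp add: a_assoc[symmetric] r_neg)
  then have "x \<diamondop> u a = x \<diamondop> u \<delta> \<diamondop> u (\<ominus> \<delta> \<oplus> a)"
    using \<delta> assms by (simp add: uu)
  also have "\<dots> = (x \<diamondop> u \<delta>) \<diamondop> u (\<ominus> \<delta> \<oplus> a)"
    using \<delta> assms by (simp add: P.m_assoc all_forms_closed)
  finally show ?thesis
    using e \<delta> assms all_forms_u_unit by simp
qed

lemma one_all_forms: "\<one>\<^bsub>P\<^esub> \<in> all_forms"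
proof -
  \<comment> \<open>With \<open>w\<close> in the big cell, the identity
    \<open>w \<diamondop> w\<close> lies in its translate.\<close>
  have "w = h \<one> \<diamondop> u \<zero> \<diamondop> w \<diamondop> u \<zero>" by simp
  then have "w \<in> big_cell" using big_cellI[of \<one> \<zero> \<zero>] by simp
  then show ?thesis using ww by (auto simp: all_forms_def)
qed

lemma generate_all_forms:
  assumes "g \<in> generate P (h ` Units R \<union> u ` Asym \<union> {w})"
  shows "g \<in> all_forms"
proof -
  let ?S = "h ` Units R \<union> u ` Asym \<union> {w}"
  have S: "?S \<subseteq> carrier P" by auto
  have gen: "x \<diamondop> s \<in> all_forms" "x \<diamondop> inv\<^bsub>P\<^esub> s \<in> all_forms"
    if "x \<in> all_forms" "s \<in> ?S" for x s
    using that by (auto simp: inv_h inv_u inv_w all_forms_h all_forms_u all_forms_w)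
  \<comment> \<open>The claim is strengthened to right multiplication of any normal form by
    \<open>g\<close>, since a property of \<open>g\<close> alone would not pass to products in the
    induction.\<close>
  have "\<forall>x\<in>all_forms. x \<diamondop> g \<in> all_forms"
    using assms
  proof (induction rule: generate.induct)
    case (eng g1 g2)
    then have "g1 \<in> carrier P" "g2 \<in> carrier P"
      using P.generate_in_carrier[OF S] by auto
    then show ?case
      using eng by (simp add: P.m_assoc[symmetric] all_forms_closed)
  qed (auto simp: gen all_forms_closed)
  then have "\<one>\<^bsub>P\<^esub> \<diamondop> g \<in> all_forms"
    using one_all_forms by blast
  moreover have "g \<in> carrier P"
    using assms P.generate_in_carrier[OF S] by auto
  ultimately show ?thesis by simp
qed

end

section \<open>Comparison of the presented group with the matrix group\<close>

context local_involution_ring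
begin

lemma bruhat_gens_iff [simp]:
  "H t \<in> bruhat_gens R star \<longleftrightarrow> t \<in> Units R"
  "U a \<in> bruhat_gens R star \<longleftrightarrow> a \<in> Asym"
  "W \<in> bruhat_gens R star"
  by (auto simp: bruhat_gens_def)

lemma bruhat_rels_closed:
  "bruhat_rels R star \<subseteq> carrier (free_group (bruhat_gens R star)) \<times> carrier (free_group (bruhat_gens R star))"
proof -
  interpret F: group "free_group (bruhat_gens R star)" by (rule group_free_group)
  have [simp]: "free_gen (bruhat_gens R star) x \<in> carrier (free_group (bruhat_gens R star))"
    if "x \<in> bruhat_gens R star" for x
    using that by (rule free_gen_closed)
  have conj: "t \<otimes> a \<otimes> star t \<in> Asym" if "t \<in> Units R" "a \<in> Asym" for t a
    using conjugate_asym[of t a] that by (simp add: conjugate_def Units_closed)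
  show ?thesis
    unfolding bruhat_rels_def Let_def by (auto simp: conj)
qed

text \<open>Turns relations between elements of \<open>P\<close> into the condition on pairs that
  \<open>presented_group_universal\<close> asks for.\<close>

lemma bruhat_relations_imp:
  fixes \<theta> h u w
  defines "S \<equiv> bruhat_gens R star"
  assumes \<theta>: "\<theta> \<in> hom (free_group S) P"
    and h: "\<And>t. t \<in> Units R \<Longrightarrow> \<theta> (free_gen S (H t)) = h t"
    and u: "\<And>a. a \<in> Asym \<Longrightarrow> \<theta> (free_gen S (U a)) = u a"
    and w: "\<theta> (free_gen S W) = w"
    and rel: "bruhat_relations R star \<delta> P h u w"
    and lr: "(l, r) \<in> bruhat_rels R star"
  shows "\<theta> l = \<theta> r"
proof -
  interpret rel: bruhat_relations R star \<delta> P h u w by (rule rel)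
  interpret \<theta>: group_hom "free_group S" P \<theta>
    using \<theta> group_free_group rel.P.group_axioms by (intro group_hom.intro group_hom_axioms.intro)
  have [simp]: "free_gen S x \<in> carrier (free_group S)" if "x \<in> S" for x
    using that by (rule free_gen_closed)
  have conj: "t \<otimes> a \<otimes> star t \<in> Asym" if "t \<in> Units R" "a \<in> Asym" for t a
    using conjugate_asym[of t a] that by (simp add: conjugate_def Units_closed)
  have S [simp]: "H t \<in> S \<longleftrightarrow> t \<in> Units R" "U a \<in> S \<longleftrightarrow> a \<in> Asym" "W \<in> S" for t a
    by (simp_all add: S_def)
  show ?thesis
    using lr unfolding bruhat_rels_def Let_def S_def[symmetric]
    by (elim UnE CollectE exE conjE)
      (auto simp: h u w conj rel.hh rel.uu rel.hu rel.ww rel.hw rel.wu3)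
qed

text \<open>The opposite passage, needed for the projection onto the presented group: identified
  pairs yield the relations in the form used for the normal forms.\<close>

lemma bruhat_relationsI:
  fixes \<theta>
  defines "S \<equiv> bruhat_gens R star"
  assumes \<theta>: "\<theta> \<in> hom (free_group S) P" and P: "group P"
    and rel: "\<And>l r. (l, r) \<in> bruhat_rels R star \<Longrightarrow> \<theta> l = \<theta> r"
  shows "bruhat_relations R star \<delta> P (\<lambda>t. \<theta> (free_gen S (H t)))
    (\<lambda>a. \<theta> (free_gen S (U a))) (\<theta> (free_gen S W))"
proof -
  interpret P: group P by fact
  interpret \<theta>: group_hom "free_group S" P \<theta>
    using \<theta> group_free_group P by (intro group_hom.intro group_hom_axioms.intro)
  have gens [simp]: "free_gen S x \<in> carrier (free_group S)" if "x \<in> S" for x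
    using that by (rule free_gen_closed)
  have S [simp]: "H t \<in> S \<longleftrightarrow> t \<in> Units R" "U a \<in> S \<longleftrightarrow> a \<in> Asym" "W \<in> S" for t a
    by (simp_all add: S_def)
  note rels = rel[unfolded bruhat_rels_def Let_def S_def[symmetric]]
  have mult: "\<theta> x \<otimes>\<^bsub>P\<^esub> \<theta> y = \<theta> (x \<otimes>\<^bsub>free_group S\<^esub> y)"
    if "x \<in> carrier (free_group S)" "y \<in> carrier (free_group S)" for x y
    using that by simp
  show ?thesis
  proof unfold_locales
    fix s t assume "s \<in> Units R" "t \<in> Units R"
    then show "\<theta> (free_gen S (H s)) \<otimes>\<^bsub>P\<^esub> \<theta> (free_gen S (H t)) = \<theta> (free_gen S (H (s \<otimes> t)))"
      by (subst mult) (simp, simp, rule rels, blast)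
  next
    fix a b assume "a \<in> Asym" "b \<in> Asym"
    then show "\<theta> (free_gen S (U a)) \<otimes>\<^bsub>P\<^esub> \<theta> (free_gen S (U b)) = \<theta> (free_gen S (U (a \<oplus> b)))"
      by (subst mult) (simp, simp, rule rels, blast)
  next
    fix t a assume *: "t \<in> Units R" "a \<in> Asym"
    then have "t \<otimes> a \<otimes> star t \<in> Asym"
      using conjugate_asym[of t a] by (simp add: conjugate_def Units_closed)
    moreover have "\<theta> (free_gen S (H t) \<otimes>\<^bsub>free_group S\<^esub> free_gen S (U a)) =
        \<theta> (free_gen S (U (t \<otimes> a \<otimes> star t)) \<otimes>\<^bsub>free_group S\<^esub> free_gen S (H t))"
      using * by (intro rels) blast
    ultimately show "\<theta> (free_gen S (H t)) \<otimes>\<^bsub>P\<^esub> \<theta> (free_gen S (U a)) =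
        \<theta> (free_gen S (U (t \<otimes> a \<otimes> star t))) \<otimes>\<^bsub>P\<^esub> \<theta> (free_gen S (H t))"
      using * by simp
  next
    show "\<theta> (free_gen S W) \<otimes>\<^bsub>P\<^esub> \<theta> (free_gen S W) = \<one>\<^bsub>P\<^esub>"
      unfolding \<theta>.hom_one[symmetric] by (subst mult) (simp, rule rels, blast)
  next
    fix t assume *: "t \<in> Units R"
    have "\<theta> (free_gen S (H t) \<otimes>\<^bsub>free_group S\<^esub> free_gen S W) =
        \<theta> (free_gen S W \<otimes>\<^bsub>free_group S\<^esub> free_gen S (H (inv (star t))))"
      using * by (intro rels) blast
    then show "\<theta> (free_gen S (H t)) \<otimes>\<^bsub>P\<^esub> \<theta> (free_gen S W) =
        \<theta> (free_gen S W) \<otimes>\<^bsub>P\<^esub> \<theta> (free_gen S (H (inv (star t))))"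
      using * by simp
  next
    fix t assume *: "t \<in> Units R" "t \<in> Asym"
    let ?w = "free_gen S W" and ?u = "\<lambda>a. free_gen S (U a)"
    have "\<theta> (?w \<otimes>\<^bsub>free_group S\<^esub> ?u (inv t) \<otimes>\<^bsub>free_group S\<^esub> ?w \<otimes>\<^bsub>free_group S\<^esub> ?u (\<ominus> t)
        \<otimes>\<^bsub>free_group S\<^esub> ?w \<otimes>\<^bsub>free_group S\<^esub> ?u (inv t)) = \<theta> (free_gen S (H (\<ominus> t)))"
      using * by (intro rels) blast
    then show "\<theta> ?w \<otimes>\<^bsub>P\<^esub> \<theta> (?u (inv t)) \<otimes>\<^bsub>P\<^esub> \<theta> ?w \<otimes>\<^bsub>P\<^esub> \<theta> (?u (\<ominus> t)) \<otimes>\<^bsub>P\<^esub> \<theta> ?w \<otimes>\<^bsub>P\<^esub> \<theta> (?u (inv t))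
        = \<theta> (free_gen S (H (\<ominus> t)))"
      using * by simp
  qed simp_all
qed

lemma matrices_bruhat_relations:
  "bruhat_relations R star \<delta> (SL_star1 R star) (\<lambda>t. bruhat_matrix R star (H t))
    (\<lambda>a. bruhat_matrix R star (U a)) (bruhat_matrix R star W)"
proof -
  interpret SL: group "SL_star1 R star" by (rule SL_group)
  have dual: "inv (star t) = dual t" for t by (simp add: dual_def)
  show ?thesis
  proof unfold_locales
    fix t assume t: "t \<in> Units R" "t \<in> Asym"
    \<comment> \<open>Skewness gives \<open>star (\<ominus> t) = t\<close>, which identifies the
      lower right entry of the matrix of \<open>H (\<ominus> t)\<close>.\<close>
    then have "inv (star (\<ominus> t)) = inv t"
      by (simp add: asym_elems_def del: asym_closed)
    then show "bruhat_matrix R star W \<otimes>\<^bsub>SL_star1 R star\<^esub> bruhat_matrix R star (U (inv t))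
      \<otimes>\<^bsub>SL_star1 R star\<^esub> bruhat_matrix R star W \<otimes>\<^bsub>SL_star1 R star\<^esub> bruhat_matrix R star (U (\<ominus> t))
      \<otimes>\<^bsub>SL_star1 R star\<^esub> bruhat_matrix R star W \<otimes>\<^bsub>SL_star1 R star\<^esub> bruhat_matrix R star (U (inv t)) =
      bruhat_matrix R star (H (\<ominus> t))"
      using t(1) by (simp add: SL_mult Units_closed l_neg r_neg l_minus r_minus)
  next
    fix t a assume "t \<in> Units R" "a \<in> Asym"
    moreover from this have "t \<otimes> a \<otimes> star t \<otimes> inv (star t) = t \<otimes> a"
      by (simp add: m_assoc Units_closed)
    ultimately show "bruhat_matrix R star (H t) \<otimes>\<^bsub>SL_star1 R star\<^esub> bruhat_matrix R star (U a) =
      bruhat_matrix R star (U (t \<otimes> a \<otimes> star t)) \<otimes>\<^bsub>SL_star1 R star\<^esub> bruhat_matrix R star (H t)"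
      by (simp add: SL_mult Units_closed)
  qed (simp_all add: bruhat_matrix_closed del: bruhat_matrix.simps,
      simp_all add: SL_mult SL_one dual Units_closed inv_mult_Units a_comm)
qed

text \<open>The parameters can be read off: the lower row determines \<open>t\<close> and
  \<open>y\<close>, and then the upper left entry determines \<open>x\<close>.\<close>

lemma bruhat_matrix_form:
  assumes "t \<in> Units R" "x \<in> Asym" "y \<in> Asym"
  shows "bruhat_matrix R star (H t) \<otimes>\<^bsub>SL_star1 R star\<^esub> (bruhat_matrix R star (U x)
      \<otimes>\<^bsub>SL_star1 R star\<^esub> (bruhat_matrix R star W \<otimes>\<^bsub>SL_star1 R star\<^esub> bruhat_matrix R star (U y))) =
    mat2 (t \<otimes> x) (t \<otimes> (x \<otimes> y \<oplus> \<one>)) (dual t) (dual t \<otimes> y)"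
proof -
  have "dual t \<in> carrier R"
    using assms by (simp add: Units_closed)
  moreover have "inv (star t) = dual t"
    by (simp add: dual_def)
  ultimately show ?thesis
    using assms by (simp add: SL_mult Units_closed a_comm)
qed

lemma zero_not_unit: "\<zero> \<notin> Units R"
  by (metis Units_inv_closed Units_r_inv l_null one_not_zero)

text \<open>Comparison with \<open>bruhat_matrix_form\<close> forces \<open>t = dual c\<close>,
  \<open>x = star c \<otimes> a\<close> and \<open>y = inv c \<otimes> d\<close>. The upper right
  entry then agrees because of the second equation of \<open>E\<close>.\<close>

lemma SL_bruhat:
  assumes "mat2 a b c d \<in> carrier (SL_star1 R star)" "c \<in> Units R"
  obtains t x y where "t \<in> Units R" "x \<in> Asym" "y \<in> Asym"
    "mat2 a b c d = mat2 (t \<otimes> x) (t \<otimes> (x \<otimes> y \<oplus> \<one>)) (dual t) (dual t \<otimes> y)"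
proof
  from assms have carr [simp]: "a \<in> carrier R" "b \<in> carrier R" "c \<in> carrier R" "d \<in> carrier R"
    and E: "star c \<otimes> a \<oplus> star a \<otimes> c = \<zero>" "star c \<otimes> b \<oplus> star a \<otimes> d = \<one>"
    by (auto simp: mat2_in_SL)
  have carr' [simp]: "star a \<in> carrier R" "star c \<in> carrier R" "inv c \<in> carrier R" "inv (star c) \<in> carrier R"
    using assms(2) by auto
  \<comment> \<open>This equation for the lower row comes from the adjoint matrix; it makes
    \<open>d \<otimes> star c\<close> skew, and \<open>inv c \<otimes> d\<close> is a twist of that
    element.\<close>
  have dc: "c \<otimes> star d \<oplus> d \<otimes> star c = \<zero>"
    using SL_adjoint_closed[OF assms(1)] by (auto simp: mat2_in_SL)
  show "dual c \<in> Units R"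
    using assms(2) by simp
  have x: "star a \<otimes> c = \<ominus> (star c \<otimes> a)"
    using E(1) by (metis carr carr' m_closed minus_equality minus_minus)
  show "star c \<otimes> a \<in> Asym"
    using x by (simp add: asym_iff m_comm del: asym_closed)
  have "c \<otimes> star d = \<ominus> (d \<otimes> star c)"
    using dc by (metis carr carr' m_closed minus_equality star.hom_closed)
  then have "d \<otimes> star c \<in> Asym"
    by (simp add: asym_iff m_comm del: asym_closed)
  then have "conjugate (inv c) (d \<otimes> star c) \<in> Asym"
    by simp
  moreover have "conjugate (inv c) (d \<otimes> star c) = inv c \<otimes> d"
    using assms(2) by (simp add: conjugate_def star_inv m_assoc)
  ultimately show "inv c \<otimes> d \<in> Asym"
    by simp
  have "star c \<otimes> a \<otimes> (inv c \<otimes> d) \<oplus> \<one> = \<ominus> (star a \<otimes> c) \<otimes> (inv c \<otimes> d) \<oplus> \<one>"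
    by (simp add: x)
  also have "\<dots> = \<ominus> (star a \<otimes> (c \<otimes> inv c) \<otimes> d) \<oplus> \<one>"
    by (simp add: l_minus m_assoc del: Units_r_inv)
  also have "\<dots> = \<ominus> (star a \<otimes> d) \<oplus> \<one>"
    using assms(2) by simp
  also have "\<dots> = star c \<otimes> b"
    unfolding E(2)[symmetric] by (simp add: a_comm[of "star c \<otimes> b"] a_assoc[symmetric] l_neg)
  finally have b: "dual c \<otimes> (star c \<otimes> a \<otimes> (inv c \<otimes> d) \<oplus> \<one>) = b"
    using assms(2) by (simp add: dual_def m_assoc[symmetric])
  have "dual c \<otimes> (star c \<otimes> a) = a"
    using assms(2) by (simp add: dual_def m_assoc[symmetric])
  moreover have "dual (dual c) = c" "c \<otimes> (inv c \<otimes> d) = d"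
    using assms(2) by (simp_all add: m_assoc[symmetric])
  ultimately show "mat2 a b c d = mat2 (dual c \<otimes> (star c \<otimes> a))
      (dual c \<otimes> (star c \<otimes> a \<otimes> (inv c \<otimes> d) \<oplus> \<one>)) (dual (dual c)) (dual (dual c) \<otimes> (inv c \<otimes> d))"
    using b by simp
qed

text \<open>Since \<open>star c \<otimes> b\<close> is a nonunit, locality applied to
  \<open>star c \<otimes> b \<oplus> star a \<otimes> d = \<one>\<close> makes \<open>a\<close> a
  unit. The claim is then a sum of a unit and a nonunit.\<close>

lemma shear_lower_left_unit:
  assumes "mat2 a b c d \<in> carrier (SL_star1 R star)" "c \<notin> Units R"
  shows "c \<oplus> \<delta> \<otimes> a \<in> Units R"
proof -
  have carr: "a \<in> carrier R" "b \<in> carrier R" "c \<in> carrier R" "d \<in> carrier R"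
    and E: "star c \<otimes> b \<oplus> star a \<otimes> d = \<one>"
    using assms(1) by (auto simp: mat2_in_SL)
  have "star c \<notin> Units R"
    using assms(2) carr star_Units[of "star c"] by auto
  then have "star c \<otimes> b \<notin> Units R"
    using carr unit_factor[of "star c" b] by auto
  then have "star a \<otimes> d \<in> Units R"
    using local_ring[of "star c \<otimes> b" "star a \<otimes> d"] E carr by auto
  then have "star a \<in> Units R"
    using carr unit_factor[of "star a" d] by auto
  then have "a \<in> Units R"
    using carr star_Units[of "star a"] by auto
  then have "\<delta> \<otimes> a \<oplus> c \<in> Units R"
    using \<delta> assms(2) carr by (intro unit_add_nonunit) auto
  then show ?thesis
    using \<delta> carr \<open>a \<in> Units R\<close> by (simp add: a_comm Units_closed)
qed

theorem SL_bruhat_presentation: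
  "is_presented_by (SL_star1 R star) (bruhat_gens R star) (bruhat_rels R star) (bruhat_matrix R star)"
proof -
  let ?G = "SL_star1 R star" and ?S = "bruhat_gens R star" and ?R = "bruhat_rels R star"
  let ?M = "bruhat_matrix R star" and ?P = "presented_group ?S ?R" and ?g = "presented_gen ?S ?R"
  interpret G: group ?G by (rule SL_group)
  interpret P: group ?P by (rule group_presented_group[OF bruhat_rels_closed])
  have M_closed: "?M ` ?S \<subseteq> carrier ?G"
    using bruhat_matrix_closed by auto
  obtain \<psi> where \<psi>: "\<psi> \<in> hom (free_group ?S) ?G" "\<And>x. x \<in> ?S \<Longrightarrow> \<psi> (free_gen ?S x) = ?M x"
    using G.free_group_universal[OF M_closed] by blast
  have \<psi>_hom: "group_hom (free_group ?S) ?G \<psi>"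
    using \<psi>(1) group_free_group G.group_axioms by (intro group_hom.intro group_hom_axioms.intro)
  have "\<psi> l = \<psi> r" if "(l, r) \<in> ?R" for l r
    by (rule bruhat_relations_imp[OF \<psi>(1) _ _ _ matrices_bruhat_relations that])
      (simp_all add: \<psi>(2) del: bruhat_matrix.simps)
  then obtain \<phi> where \<phi>: "\<phi> \<in> hom ?P ?G" "\<And>x. x \<in> ?S \<Longrightarrow> \<phi> (?g x) = ?M x"
    using presented_group_universal[OF bruhat_rels_closed \<psi>_hom] \<psi>(2) by metis
  interpret \<phi>: group_hom ?P ?G \<phi>
    using \<phi>(1) by unfold_locales
  interpret rel: bruhat_relations R star \<delta> ?P "\<lambda>t. ?g (H t)" "\<lambda>a. ?g (U a)" "?g W"
    using bruhat_relationsI[OF presented_proj_hom[OF bruhat_rels_closed] P.group_axioms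
        presented_proj_rel[OF bruhat_rels_closed]]
    by (simp add: presented_gen_def)
  have "?g ` ?S = (\<lambda>t. ?g (H t)) ` Units R \<union> (\<lambda>a. ?g (U a)) ` Asym \<union> {?g W}"
    by (auto simp: bruhat_gens_def)
  then have forms: "x \<in> rel.all_forms" if "x \<in> carrier ?P" for x
    using that rel.generate_all_forms generate_presented_gen[OF bruhat_rels_closed] by simp
  have form: "\<phi> (?g (H t) \<otimes>\<^bsub>?P\<^esub> (?g (U x) \<otimes>\<^bsub>?P\<^esub> (?g W \<otimes>\<^bsub>?P\<^esub> ?g (U y)))) =
      mat2 (t \<otimes> x) (t \<otimes> (x \<otimes> y \<oplus> \<one>)) (dual t) (dual t \<otimes> y)"
    if "t \<in> Units R" "x \<in> Asym" "y \<in> Asym" for t x y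
    unfolding bruhat_matrix_form[OF that, symmetric]
    using that by (simp add: \<phi>(2) del: bruhat_matrix.simps)
  have "x = \<one>\<^bsub>?P\<^esub>" if x: "x \<in> carrier ?P" "\<phi> x = \<one>\<^bsub>?G\<^esub>" for x
    using forms[OF x(1)]
  proof (cases rule: rel.all_forms_cases)
    case big
    then obtain t a b where x_eq: "x = ?g (H t) \<otimes>\<^bsub>?P\<^esub> (?g (U a) \<otimes>\<^bsub>?P\<^esub> (?g W \<otimes>\<^bsub>?P\<^esub> ?g (U b)))"
      and *: "t \<in> Units R" "a \<in> Asym" "b \<in> Asym"
      by (auto simp: rel.big_cell_def)
    \<comment> \<open>The lower left entry is \<open>dual t\<close>, a unit, whereas that of the
      identity matrix is zero.\<close>
    have "dual t = \<zero>"
      using x(2) unfolding x_eq form[OF *] by (simp add: SL_one)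
    with *(1) show ?thesis
      using dual_Units zero_not_unit by metis
  next
    case (small t a b)
    let ?y = "?g (H t) \<otimes>\<^bsub>?P\<^esub> (?g (U a) \<otimes>\<^bsub>?P\<^esub> (?g W \<otimes>\<^bsub>?P\<^esub> ?g (U b)))"
    have "x = ?y \<otimes>\<^bsub>?P\<^esub> ?g W"
      using small by (simp add: P.m_assoc)
    then have "\<phi> x = \<phi> ?y \<otimes>\<^bsub>?G\<^esub> ?M W"
      using small by (simp add: \<phi>(2) del: bruhat_matrix.simps)
    \<comment> \<open>Right multiplication by the matrix of \<open>W\<close> swaps the columns, so
      comparison with the identity gives first \<open>dual t = \<one>\<close> and then
      \<open>a = \<zero>\<close> and \<open>b = \<zero>\<close>.\<close>
    then have "\<phi> x = mat2 (t \<otimes> (a \<otimes> b \<oplus> \<one>)) (t \<otimes> a) (dual t \<otimes> b) (dual t)"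
      using small(2-4) unfolding form[OF small(2-4)] by (simp add: SL_mult Units_closed)
    from HOL.trans[OF this[symmetric] x(2)[unfolded SL_one]]
    have *: "t \<otimes> a = \<zero> \<and> dual t \<otimes> b = \<zero> \<and> dual t = \<one>"
      by (auto simp only: mat2_eq_iff)
    then have "t = \<one>"
      using dual_dual[OF small(2)] by simp
    then have "t = \<one>" "a = \<zero>" "b = \<zero>"
      using * small by simp_all
    then show ?thesis
      using small(1) rel.ww by simp
  qed
  then have "kernel ?P ?G \<phi> = {\<one>\<^bsub>?P\<^esub>}"
    by (auto simp: kernel_def)
  then have inj: "inj_on \<phi> (carrier ?P)"
    by (rule \<phi>.trivial_ker_imp_inj)
  have big: "mat2 a b c d \<in> \<phi> ` carrier ?P"
    if "mat2 a b c d \<in> carrier ?G" "c \<in> Units R" for a b c d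
  proof (rule SL_bruhat[OF that])
    fix t x y assume *: "t \<in> Units R" "x \<in> Asym" "y \<in> Asym"
      and "mat2 a b c d = mat2 (t \<otimes> x) (t \<otimes> (x \<otimes> y \<oplus> \<one>)) (dual t) (dual t \<otimes> y)"
    then have "mat2 a b c d = \<phi> (?g (H t) \<otimes>\<^bsub>?P\<^esub> (?g (U x) \<otimes>\<^bsub>?P\<^esub> (?g W \<otimes>\<^bsub>?P\<^esub> ?g (U y))))"
      by (simp only: form)
    then show ?thesis
      by (rule image_eqI) (use * in simp)
  qed
  have "g \<in> \<phi> ` carrier ?P" if g: "g \<in> carrier ?G" for g
  proof -
    obtain a b c d where g_eq: "g = mat2 a b c d" by (rule mat2_cases)
    note E = g[unfolded g_eq]
    show ?thesis
    proof (cases "c \<in> Units R")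
      case True
      then show ?thesis using big E g_eq by blast
    next
      case False
      \<comment> \<open>This element maps to the lower unitriangular matrix with entry
        \<open>\<delta>\<close>, which adds \<open>\<delta>\<close> times the first row to the
        second.\<close>
      let ?v = "?g W \<otimes>\<^bsub>?P\<^esub> (?g (U \<delta>) \<otimes>\<^bsub>?P\<^esub> ?g W)"
      have v: "?v \<in> carrier ?P" using \<delta> by simp
      have "\<phi> ?v = ?M W \<otimes>\<^bsub>?G\<^esub> (?M (U \<delta>) \<otimes>\<^bsub>?G\<^esub> ?M W)"
        using \<delta> by (simp add: \<phi>(2) del: bruhat_matrix.simps)
      then have "\<phi> ?v = mat2 \<one> \<zero> \<delta> \<one>"
        using \<delta> by (simp add: SL_mult)
      then have eq: "\<phi> ?v \<otimes>\<^bsub>?G\<^esub> g = mat2 a b (\<delta> \<otimes> a \<oplus> c) (\<delta> \<otimes> b \<oplus> d)"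
        using E \<delta> by (auto simp: g_eq SL_mult mat2_in_SL)
      moreover have "\<phi> ?v \<otimes>\<^bsub>?G\<^esub> g \<in> carrier ?G"
        using v g by simp
      moreover have "\<delta> \<otimes> a \<oplus> c \<in> Units R"
        using shear_lower_left_unit[OF E False] E \<delta> by (simp add: a_comm mat2_in_SL)
      ultimately have "\<phi> ?v \<otimes>\<^bsub>?G\<^esub> g \<in> \<phi> ` carrier ?P"
        using big by simp
      then obtain y where y: "y \<in> carrier ?P" "\<phi> ?v \<otimes>\<^bsub>?G\<^esub> g = \<phi> y"
        by auto
      then have "g = \<phi> (inv\<^bsub>?P\<^esub> ?v \<otimes>\<^bsub>?P\<^esub> y)"
        using v g by (metis G.inv_solve_left \<phi>.hom_closed \<phi>.hom_inv \<phi>.hom_mult P.inv_closed)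
      then show ?thesis
        using v y(1) by blast
    qed
  qed
  then have "\<phi> ` carrier ?P = carrier ?G"
    by auto
  then have "\<phi> \<in> iso ?P ?G"
    using \<phi>(1) inj by (simp add: iso_def bij_betw_def)
  then show ?thesis
    unfolding is_presented_by_def using \<phi>(2) by blast
qed

end

section \<open>Truncated polynomials\<close>

lemma (in ring) a_rcosets_cases:
  assumes "c \<in> carrier (R Quot I)"
  obtains p where "p \<in> carrier R" "c = I +> p"
  using assms by (auto simp: FactRing_def A_RCOSETS_def')

text \<open>The cofactor is the geometric sum, which the induction extends by one power of
  \<open>y\<close> at a time.\<close>

lemma (in cring) one_minus_dvd_one_minus_pow:
  assumes y: "y \<in> carrier R"
  shows "\<exists>v\<in>carrier R. (\<one> \<ominus> y) \<otimes> v = \<one> \<ominus> y [^] (n::nat)"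
proof (induction n)
  case 0
  have "(\<one> \<ominus> y) \<otimes> \<zero> = \<one> \<ominus> \<one>"
    using y by (simp add: a_minus_def r_neg)
  then show ?case by auto
next
  case (Suc n)
  then obtain v where v: "v \<in> carrier R" "(\<one> \<ominus> y) \<otimes> v = \<one> \<ominus> y [^] n" by auto
  let ?p = "y [^] n"
  have p: "?p \<in> carrier R" using y by simp
  have "(\<one> \<ominus> y) \<otimes> (v \<oplus> ?p) = (\<one> \<ominus> y) \<otimes> v \<oplus> (\<one> \<ominus> y) \<otimes> ?p"
    using v(1) y p by (simp add: r_distr)
  also have "\<dots> = (\<one> \<ominus> ?p) \<oplus> (\<one> \<ominus> y) \<otimes> ?p"
    by (simp add: v(2))
  also have "\<dots> = \<one> \<ominus> ?p \<otimes> y"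
    using y p by algebra
  finally show ?case
    using v(1) p by (intro bexI[of _ "v \<oplus> ?p"]) simp_all
qed

text \<open>Factor out \<open>u\<close>: the sum is \<open>u \<otimes> (\<one> \<ominus> ?y)\<close>
  with \<open>?y\<close> nilpotent, and \<open>\<one> \<ominus> ?y\<close> divides
  \<open>\<one> \<ominus> ?y [^] n = \<one>\<close>.\<close>

lemma (in cring) unit_add_nilpotent:
  assumes u: "u \<in> Units R" and z: "z \<in> carrier R" "z [^] (n::nat) = \<zero>"
  shows "u \<oplus> z \<in> Units R"
proof -
  let ?y = "\<ominus> (inv u) \<otimes> z"
  have carr: "u \<in> carrier R" "inv u \<in> carrier R" "?y \<in> carrier R"
    using u z by auto
  have "?y [^] n = (\<ominus> (inv u)) [^] n \<otimes> z [^] n"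
    using carr z(1) by (intro pow_mult_distrib) (simp_all add: m_comm)
  then have "?y [^] n = \<zero>"
    using z carr by simp
  then obtain v where "v \<in> carrier R" "(\<one> \<ominus> ?y) \<otimes> v = \<one>"
    using one_minus_dvd_one_minus_pow[OF carr(3), of n] by (auto simp: a_minus_def)
  then have "\<one> \<ominus> ?y \<in> Units R"
    using carr(3) unit_factor[of "\<one> \<ominus> ?y" v] by simp
  then have "u \<otimes> (\<one> \<ominus> ?y) \<in> Units R"
    using u by simp
  moreover have "u \<otimes> (\<one> \<ominus> ?y) = u \<oplus> z"
    using carr z(1) u by (simp add: a_minus_def r_distr l_minus m_assoc[symmetric])
  ultimately show ?thesis by simp
qed

section \<open>Passing an involution to a quotient\<close>

context involution_ring
begin

text \<open>Being its own inverse, \<open>star\<close> maps \<open>I\<close> onto itself, so the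
  image of a coset is a full coset. This is why taking images defines the involution on the
  quotient.\<close>

lemma star_image_coset:
  assumes I: "ideal I R" "star ` I \<subseteq> I" and p: "p \<in> carrier R"
  shows "star ` (I +> p) = I +> star p"
proof -
  have "I \<subseteq> carrier R" using I(1) ideal.Icarr by auto
  then have eq: "star ` I = I"
    using I(2) by (auto simp: image_iff) (metis imageI star_star subset_iff)
  have "star ` (I +> p) = (\<lambda>x. x \<oplus> star p) ` star ` I"
    using \<open>I \<subseteq> carrier R\<close> p unfolding a_r_coset_def' by (auto simp: image_iff subset_iff)
  then show ?thesis
    unfolding eq by (auto simp: a_r_coset_def')
qed

lemma quotient_involution_ring:
  assumes I: "ideal I R" "star ` I \<subseteq> I"
  shows "involution_ring (R Quot I) ((`) star)"
proof -
  interpret I: ideal I R by (rule I)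
  interpret Q: cring "R Quot I" by (rule I.quotient_is_cring[OF is_cring])
  interpret \<pi>: ring_hom_ring R "R Quot I" "(+>) I" by (rule I.rcos_ring_hom_ring)
  note st = star_image_coset[OF I]
  have "(`) star \<in> ring_hom (R Quot I) (R Quot I)"
  proof (rule ring_hom_memI)
    show "star ` \<one>\<^bsub>R Quot I\<^esub> = \<one>\<^bsub>R Quot I\<^esub>"
      unfolding \<pi>.hom_one[symmetric] by (simp only: st one_closed star.hom_one)
  next
    fix c assume "c \<in> carrier (R Quot I)"
    then obtain p where p: "p \<in> carrier R" "c = I +> p" by (rule a_rcosets_cases)
    then show "star ` c \<in> carrier (R Quot I)"
      using st \<pi>.hom_closed by simp
    fix d assume "d \<in> carrier (R Quot I)"
    then obtain q where q: "q \<in> carrier R" "d = I +> q" by (rule a_rcosets_cases)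
    have "c \<otimes>\<^bsub>R Quot I\<^esub> d = I +> (p \<otimes> q)" "c \<oplus>\<^bsub>R Quot I\<^esub> d = I +> (p \<oplus> q)"
      "star ` c \<otimes>\<^bsub>R Quot I\<^esub> star ` d = I +> (star p \<otimes> star q)"
      "star ` c \<oplus>\<^bsub>R Quot I\<^esub> star ` d = I +> (star p \<oplus> star q)"
      using p q st by simp_all
    then show "star ` (c \<otimes>\<^bsub>R Quot I\<^esub> d) = star ` c \<otimes>\<^bsub>R Quot I\<^esub> star ` d"
      "star ` (c \<oplus>\<^bsub>R Quot I\<^esub> d) = star ` c \<oplus>\<^bsub>R Quot I\<^esub> star ` d"
      using p(1) q(1) by (simp_all only: st m_closed a_closed star.hom_mult star.hom_add)
  qed
  then show ?thesis
  proof unfold_locales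
    fix c assume "c \<in> carrier (R Quot I)"
    then obtain p where p: "p \<in> carrier R" "c = I +> p" by (rule a_rcosets_cases)
    then show "star ` star ` c = c"
      using st by simp
  qed
qed

end

section \<open>The involution on polynomials that stars coefficients and negates the
  variable\<close>

locale poly_involution = UP_cring R P + involution_ring R star
  for R (structure) and P (structure) and star
begin

definition skew :: "(nat \<Rightarrow> 'a) \<Rightarrow> nat \<Rightarrow> 'a" where
  "skew p = (\<lambda>i. (\<ominus> \<one>) [^] i \<otimes> star (up_ring.coeff P p i))"

lemma sign_star: "star ((\<ominus> \<one>) [^] (i::nat)) = (\<ominus> \<one>) [^] i"
  by (induction i) simp_all

lemma sign_square: "(\<ominus> \<one>) [^] (i::nat) \<otimes> (\<ominus> \<one>) [^] i = \<one>"
proof -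
  have "(\<ominus> \<one>) [^] i \<otimes> (\<ominus> \<one>) [^] i = (\<ominus> \<one> \<otimes> \<ominus> \<one>) [^] i"
    by (rule R.pow_mult_distrib[symmetric]) simp_all
  then show ?thesis by (simp add: R.l_minus)
qed

lemma carrier_UP: "carrier P = up R"
  by (simp add: P_def UP_def)

text \<open>A polynomial is represented by its own coefficient function; hence the function
  \<open>skew p\<close> can itself be shown to be a polynomial.\<close>

lemma coeff_UP: "p \<in> up R \<Longrightarrow> up_ring.coeff P p = p"
  unfolding P_def UP_def by (simp only: up_ring.simps restrict_apply if_True)

lemma skew_closed [simp]:
  assumes "p \<in> carrier P"
  shows "skew p \<in> carrier P"
proof -
  have p: "p \<in> up R" "up_ring.coeff P p = p"
    using assms coeff_UP unfolding carrier_UP by blast+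
  then obtain n where "bound \<zero> n p" by auto
  then have "bound \<zero> n (skew p)"
    using p by (auto simp: skew_def bound_def)
  moreover have "skew p i \<in> carrier R" for i
    using assms by (simp add: skew_def)
  ultimately have "skew p \<in> up R" by blast
  then show ?thesis unfolding carrier_UP .
qed

lemma coeff_skew [simp]:
  assumes "p \<in> carrier P"
  shows "up_ring.coeff P (skew p) i = (\<ominus> \<one>) [^] i \<otimes> star (up_ring.coeff P p i)"
proof -
  have "up_ring.coeff P (skew p) = skew p"
    using skew_closed[OF assms] coeff_UP unfolding carrier_UP by blast
  then show ?thesis by (simp add: skew_def)
qed

text \<open>In the n-th coefficient of the product, the sign splits along each summand into the
  signs for \<open>i\<close> and \<open>n - i\<close>.\<close>

lemma skew_mult:
  assumes p: "p \<in> carrier P" and q: "q \<in> carrier P"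
  shows "skew (p \<otimes>\<^bsub>P\<^esub> q) = skew p \<otimes>\<^bsub>P\<^esub> skew q"
proof (rule up_eqI)
  fix n
  have carr: "(\<lambda>i. up_ring.coeff P p i \<otimes> up_ring.coeff P q (n - i)) \<in> {..n} \<rightarrow> carrier R"
    using p q by simp
  have "up_ring.coeff P (skew (p \<otimes>\<^bsub>P\<^esub> q)) n =
      (\<ominus> \<one>) [^] n \<otimes> (\<Oplus>i\<in>{..n}. star (up_ring.coeff P p i) \<otimes> star (up_ring.coeff P q (n - i)))"
    using p q star.hom_finsum[OF carr] by (simp add: comp_def)
  also have "\<dots> = (\<Oplus>i\<in>{..n}. (\<ominus> \<one>) [^] n \<otimes> (star (up_ring.coeff P p i) \<otimes> star (up_ring.coeff P q (n - i))))"
    using p q by (intro R.finsum_rdistr) auto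
  also have "\<dots> = (\<Oplus>i\<in>{..n}. up_ring.coeff P (skew p) i \<otimes> up_ring.coeff P (skew q) (n - i))"
  proof (rule R.finsum_cong')
    fix i assume "i \<in> {..n}"
    then have "(\<ominus> \<one>) [^] n = (\<ominus> \<one>) [^] i \<otimes> (\<ominus> \<one>) [^] (n - i)"
      by (simp add: R.nat_pow_mult)
    then show "(\<ominus> \<one>) [^] n \<otimes> (star (up_ring.coeff P p i) \<otimes> star (up_ring.coeff P q (n - i))) =
        up_ring.coeff P (skew p) i \<otimes> up_ring.coeff P (skew q) (n - i)"
      using p q by (simp add: R.m_ac)
  qed (use p q in auto)
  also have "\<dots> = up_ring.coeff P (skew p \<otimes>\<^bsub>P\<^esub> skew q) n"
    using p q by (simp del: coeff_skew)
  finally show "up_ring.coeff P (skew (p \<otimes>\<^bsub>P\<^esub> q)) n = up_ring.coeff P (skew p \<otimes>\<^bsub>P\<^esub> skew q) n" .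
qed (use p q in simp_all)

lemma skew_involution_ring: "involution_ring P skew"
proof -
  have "skew \<in> ring_hom P P"
  proof (rule ring_hom_memI)
    fix p q assume "p \<in> carrier P" "q \<in> carrier P"
    then show "skew (p \<oplus>\<^bsub>P\<^esub> q) = skew p \<oplus>\<^bsub>P\<^esub> skew q"
      by (intro up_eqI) (simp_all add: R.r_distr)
  next
    show "skew \<one>\<^bsub>P\<^esub> = \<one>\<^bsub>P\<^esub>"
      by (intro up_eqI) simp_all
  qed (simp_all add: skew_mult)
  moreover have "skew (skew p) = p" if "p \<in> carrier P" for p
    using that by (intro up_eqI) (simp_all add: sign_star sign_square R.m_assoc[symmetric])
  ultimately show ?thesis
    by unfold_locales
qed

sublocale skew: involution_ring P skew
  by (rule skew_involution_ring)

abbreviation var where "var \<equiv> up_ring.monom P \<one> 1"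

lemma skew_var: "skew var = \<ominus>\<^bsub>P\<^esub> var"
  by (rule up_eqI) (auto simp: R.l_minus)

text \<open>The n-th power of the variable is mapped to itself up to a sign, and the sign is
  absorbed into the cofactor.\<close>

lemma skew_var_pow_ideal: "skew ` (PIdl\<^bsub>P\<^esub> (var [^]\<^bsub>P\<^esub> (n::nat))) \<subseteq> PIdl\<^bsub>P\<^esub> (var [^]\<^bsub>P\<^esub> n)"
proof
  fix s assume "s \<in> skew ` (PIdl\<^bsub>P\<^esub> (var [^]\<^bsub>P\<^esub> n))"
  then obtain r where r: "r \<in> carrier P" "s = skew (r \<otimes>\<^bsub>P\<^esub> var [^]\<^bsub>P\<^esub> n)"
    by (auto simp: cgenideal_def)
  have var: "var \<in> carrier P" by simp
  have "skew (var [^]\<^bsub>P\<^esub> n) = (\<ominus>\<^bsub>P\<^esub> var) [^]\<^bsub>P\<^esub> n"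
    using skew.star.hom_pow[OF var] skew_var by simp
  also have "\<ominus>\<^bsub>P\<^esub> var = \<ominus>\<^bsub>P\<^esub> \<one>\<^bsub>P\<^esub> \<otimes>\<^bsub>P\<^esub> var"
    by (simp add: P.l_minus)
  also have "\<dots> [^]\<^bsub>P\<^esub> n = (\<ominus>\<^bsub>P\<^esub> \<one>\<^bsub>P\<^esub>) [^]\<^bsub>P\<^esub> n \<otimes>\<^bsub>P\<^esub> var [^]\<^bsub>P\<^esub> n"
    by (rule P.pow_mult_distrib) (simp_all add: P.m_comm)
  finally have "s = (skew r \<otimes>\<^bsub>P\<^esub> (\<ominus>\<^bsub>P\<^esub> \<one>\<^bsub>P\<^esub>) [^]\<^bsub>P\<^esub> n) \<otimes>\<^bsub>P\<^esub> var [^]\<^bsub>P\<^esub> n"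
    using r by (simp add: P.m_assoc)
  then show "s \<in> PIdl\<^bsub>P\<^esub> (var [^]\<^bsub>P\<^esub> n)"
    using r unfolding cgenideal_def by blast
qed

end

section \<open>A criterion for the quotient to be local\<close>

context involution_ring
begin

text \<open>\<open>\<rho>\<close> plays the role of the reduction to the residue field: it detects the units modulo \<open>I\<close>.\<close>

lemma local_quotient:
  assumes I: "ideal I R" "star ` I \<subseteq> I"
    and F: "field F" and \<rho>: "\<rho> \<in> ring_hom R F" "\<And>p. p \<in> I \<Longrightarrow> \<rho> p = \<zero>\<^bsub>F\<^esub>"
    and split: "\<And>p. p \<in> carrier R \<Longrightarrow> \<rho> p \<noteq> \<zero>\<^bsub>F\<^esub> \<Longrightarrow>
      \<exists>u\<in>Units R. \<exists>z\<in>carrier R. \<exists>m::nat. p = u \<oplus> z \<and> z [^] m \<in> I"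
    and d: "d \<in> Units R" "star d = \<ominus> d"
  shows "local_involution_ring (R Quot I) ((`) star) (I +> d)"
proof -
  interpret F: field F by (rule F)
  interpret \<rho>: ring_hom_cring R F \<rho>
    using \<rho>(1) by unfold_locales
  interpret I: ideal I R by (rule I(1))
  interpret Q: cring "R Quot I" by (rule I.quotient_is_cring[OF is_cring])
  interpret \<pi>: ring_hom_cring R "R Quot I" "(+>) I"
    by (rule I.rcos_ring_hom_cring[OF is_cring])
  have zero_coset: "\<zero>\<^bsub>R Quot I\<^esub> = I"
    unfolding FactRing_def by simp
  have zero: "I +> p = \<zero>\<^bsub>R Quot I\<^esub> \<longleftrightarrow> p \<in> I" if "p \<in> carrier R" for p
    unfolding zero_coset using that I.a_rcos_const I.rcos_const_imp_mem by metis
  \<comment> \<open>Since \<open>\<rho>\<close> vanishes on \<open>I\<close>, it depends only on the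
    coset.\<close>
  have \<rho>_eq: "\<rho> p = \<rho> q" if "p \<in> carrier R" "q \<in> carrier R" "I +> p = I +> q" for p q
  proof -
    have "I +> (p \<oplus> \<ominus> q) = \<zero>\<^bsub>R Quot I\<^esub>"
      using that by (simp add: Q.r_neg)
    moreover have "p \<oplus> \<ominus> q \<in> carrier R" using that by simp
    ultimately have "\<rho> (p \<oplus> \<ominus> q) = \<zero>\<^bsub>F\<^esub>"
      using zero \<rho>(2) by blast
    then have "\<rho> p \<oplus>\<^bsub>F\<^esub> \<ominus>\<^bsub>F\<^esub> \<rho> q = \<zero>\<^bsub>F\<^esub>"
      using that by simp
    then show ?thesis
      using that F.minus_equality[of "\<rho> p" "\<ominus>\<^bsub>F\<^esub> \<rho> q"] by simp
  qed
  have unit_image: "I +> u \<in> Units (R Quot I)" if u: "u \<in> Units R" for u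
  proof -
    have "u \<in> carrier R" "inv u \<in> carrier R" "u \<otimes> inv u = \<one>"
      using u by auto
    then have "(I +> u) \<otimes>\<^bsub>R Quot I\<^esub> (I +> inv u) = \<one>\<^bsub>R Quot I\<^esub>"
      by (metis \<pi>.hom_mult \<pi>.hom_one)
    then have "(I +> u) \<otimes>\<^bsub>R Quot I\<^esub> (I +> inv u) \<in> Units (R Quot I)"
      using Q.Units_one_closed by simp
    then show ?thesis
      using \<open>u \<in> carrier R\<close> \<open>inv u \<in> carrier R\<close> by (intro Q.unit_factor[of "I +> u" "I +> inv u"]) simp_all
  qed
  \<comment> \<open>Forwards, \<open>\<rho>\<close> maps an inverse modulo \<open>I\<close> to an
    inverse in the field. Backwards, \<open>split\<close> writes the coset as a unit plus a
    nilpotent element.\<close>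
  have unit_iff: "I +> p \<in> Units (R Quot I) \<longleftrightarrow> \<rho> p \<noteq> \<zero>\<^bsub>F\<^esub>" if p: "p \<in> carrier R" for p
  proof
    assume "I +> p \<in> Units (R Quot I)"
    then obtain c where c: "c \<in> carrier (R Quot I)" "(I +> p) \<otimes>\<^bsub>R Quot I\<^esub> c = \<one>\<^bsub>R Quot I\<^esub>"
      by (auto simp: Units_def)
    obtain q where q: "q \<in> carrier R" "c = I +> q"
      using c(1) by (rule a_rcosets_cases)
    have "I +> (p \<otimes> q) = I +> \<one>"
      using c(2) p q by simp
    then have "\<rho> p \<otimes>\<^bsub>F\<^esub> \<rho> q = \<one>\<^bsub>F\<^esub>"
      using \<rho>_eq[of "p \<otimes> q" \<one>] p q(1) by simp
    then show "\<rho> p \<noteq> \<zero>\<^bsub>F\<^esub>"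
      using q(1) by auto
  next
    assume "\<rho> p \<noteq> \<zero>\<^bsub>F\<^esub>"
    then obtain u z m where u: "u \<in> Units R" and z: "z \<in> carrier R" "z [^] (m::nat) \<in> I"
      and p_eq: "p = u \<oplus> z"
      using split p by blast
    have "(I +> z) [^]\<^bsub>R Quot I\<^esub> m = \<zero>\<^bsub>R Quot I\<^esub>"
      using z zero[of "z [^] m"] \<pi>.hom_pow[of z m] by simp
    then have "(I +> u) \<oplus>\<^bsub>R Quot I\<^esub> (I +> z) \<in> Units (R Quot I)"
      using z(1) u by (intro Q.unit_add_nilpotent unit_image) simp_all
    then show "I +> p \<in> Units (R Quot I)"
      using u z(1) unfolding p_eq by (simp add: Units_closed)
  qed
  show ?thesis
  proof (intro local_involution_ring.intro local_involution_ring_axioms.intro)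
    show "involution_ring (R Quot I) ((`) star)"
      by (rule quotient_involution_ring[OF I])
    have "I +> \<one> \<noteq> I +> \<zero>"
      using \<rho>_eq[of \<one> \<zero>] by auto
    then show "\<one>\<^bsub>R Quot I\<^esub> \<noteq> \<zero>\<^bsub>R Quot I\<^esub>"
      by simp
  next
    fix a b
    assume "a \<in> carrier (R Quot I)" "b \<in> carrier (R Quot I)"
      and ab: "a \<oplus>\<^bsub>R Quot I\<^esub> b \<in> Units (R Quot I)"
    obtain p where p: "p \<in> carrier R" "a = I +> p"
      using \<open>a \<in> carrier (R Quot I)\<close> by (rule a_rcosets_cases)
    obtain q where q: "q \<in> carrier R" "b = I +> q"
      using \<open>b \<in> carrier (R Quot I)\<close> by (rule a_rcosets_cases)
    \<comment> \<open>The nonunits are exactly the cosets killed by \<open>\<rho>\<close>, and these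
      are closed under addition.\<close>
    have "\<rho> (p \<oplus> q) \<noteq> \<zero>\<^bsub>F\<^esub>"
      using ab p q unit_iff[of "p \<oplus> q"] by simp
    then have "\<rho> p \<noteq> \<zero>\<^bsub>F\<^esub> \<or> \<rho> q \<noteq> \<zero>\<^bsub>F\<^esub>"
      using p q by auto
    then show "a \<in> Units (R Quot I) \<or> b \<in> Units (R Quot I)"
      using p q unit_iff by blast
  next
    show "I +> d \<in> Units (R Quot I)"
      by (rule unit_image[OF d(1)])
    have "d \<in> carrier R" using d(1) by blast
    then have "star ` (I +> d) = \<ominus>\<^bsub>R Quot I\<^esub> (I +> d)" "I +> d \<in> carrier (R Quot I)"
      using star_image_coset[OF I, of d] by (simp_all add: d(2))
    then show "I +> d \<in> asym_elems (R Quot I) ((`) star)"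
      unfolding asym_elems_def by blast
  qed
qed

end

section \<open>Truncated polynomials over a field form a local ring with involution\<close>

context poly_involution
begin

lemma coeff_zero_mult:
  "p \<in> carrier P \<Longrightarrow> q \<in> carrier P \<Longrightarrow>
    up_ring.coeff P (p \<otimes>\<^bsub>P\<^esub> q) 0 = up_ring.coeff P p 0 \<otimes> up_ring.coeff P q 0"
  by simp

lemma coeff_zero_ideal:
  assumes "n \<ge> 1" "p \<in> PIdl\<^bsub>P\<^esub> (var [^]\<^bsub>P\<^esub> (n::nat))"
  shows "up_ring.coeff P p 0 = \<zero>"
proof -
  \<comment> \<open>A positive exponent leaves a factor \<open>var\<close> to split off, and its
    constant coefficient is zero.\<close>
  obtain m where n: "n = Suc m" using assms(1) by (cases n) auto
  obtain r where r: "r \<in> carrier P" "p = r \<otimes>\<^bsub>P\<^esub> var [^]\<^bsub>P\<^esub> n"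
    using assms(2) by (auto simp: cgenideal_def)
  then have "p = r \<otimes>\<^bsub>P\<^esub> var [^]\<^bsub>P\<^esub> m \<otimes>\<^bsub>P\<^esub> var"
    by (simp add: n P.m_assoc)
  then show ?thesis
    using r(1) by (simp add: coeff_zero_mult del: coeff_mult)
qed

text \<open>Division by the variable, obtained from the remainder theorem at zero: the remainder has
  degree 0, hence is a constant, and comparing coefficients identifies it.\<close>

lemma poly_split:
  assumes "field R" "p \<in> carrier P"
  obtains q where "q \<in> carrier P" "p = up_ring.monom P (up_ring.coeff P p 0) 0 \<oplus>\<^bsub>P\<^esub> var \<otimes>\<^bsub>P\<^esub> q"
proof -
  interpret field R by fact
  have "carrier R \<noteq> {\<zero>}"
    using one_not_zero one_closed by blast
  then obtain q r where q: "q \<in> carrier P" and r: "r \<in> carrier P" "deg R r = 0"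
    and pqr: "p = (var \<ominus>\<^bsub>P\<^esub> up_ring.monom P \<zero> 0) \<otimes>\<^bsub>P\<^esub> q \<oplus>\<^bsub>P\<^esub> r"
    using remainder_theorem_exist[OF assms(2) R.zero_closed] by blast
  have p: "p = r \<oplus>\<^bsub>P\<^esub> var \<otimes>\<^bsub>P\<^esub> q"
    using q r by (subst pqr) (simp add: a_minus_def P.a_comm)
  have "up_ring.coeff P p 0 = up_ring.coeff P r 0"
    using q r(1) by (subst p) (simp add: coeff_zero_mult del: coeff_mult)
  moreover have "r = up_ring.monom P (up_ring.coeff P r 0) 0"
    by (rule deg_zero_impl_monom[OF r])
  ultimately show thesis
    using that[OF q] p by simp
qed

text \<open>Here \<open>\<rho>\<close> is the constant coefficient. A polynomial with nonzero
  constant coefficient is a unit constant plus a multiple of the variable, whose n-th power lies in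
  the ideal; the constant \<open>d\<close> supplies the skew unit.\<close>

theorem truncated_local_involution_ring:
  assumes R: "field R" and n: "n \<ge> 1" and d: "d \<in> Units R" "star d = \<ominus> d"
  shows "local_involution_ring (P Quot (PIdl\<^bsub>P\<^esub> (var [^]\<^bsub>P\<^esub> (n::nat)))) ((`) skew)
    (PIdl\<^bsub>P\<^esub> (var [^]\<^bsub>P\<^esub> n) +>\<^bsub>P\<^esub> up_ring.monom P d 0)"
proof (rule skew.local_quotient)
  let ?I = "PIdl\<^bsub>P\<^esub> (var [^]\<^bsub>P\<^esub> n)"
  have const_unit: "up_ring.monom P a 0 \<in> Units P" if a: "a \<in> Units R" for a
  proof -
    have [simp]: "a \<in> carrier R" "inv a \<in> carrier R" using a by auto
    have "up_ring.monom P a 0 \<otimes>\<^bsub>P\<^esub> up_ring.monom P (inv a) 0 = \<one>\<^bsub>P\<^esub>"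
      using a monom_mult[of a "inv a" 0 0] by simp
    then have "up_ring.monom P a 0 \<otimes>\<^bsub>P\<^esub> up_ring.monom P (inv a) 0 \<in> Units P"
      using P.Units_one_closed by simp
    then show ?thesis
      by (rule P.unit_factor) simp_all
  qed
  show "ideal ?I P"
    by (rule P.cgenideal_ideal) simp
  show "skew ` ?I \<subseteq> ?I"
    by (rule skew_var_pow_ideal)
  show "field R" by (rule R)
  show "(\<lambda>p. up_ring.coeff P p 0) \<in> ring_hom P R"
    by (rule ring_hom_memI) simp_all
  show "up_ring.coeff P p 0 = \<zero>" if "p \<in> ?I" for p
    using coeff_zero_ideal[OF n that] .
  show "\<exists>u\<in>Units P. \<exists>z\<in>carrier P. \<exists>m::nat. p = u \<oplus>\<^bsub>P\<^esub> z \<and> z [^]\<^bsub>P\<^esub> m \<in> ?I"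
    if p: "p \<in> carrier P" "up_ring.coeff P p 0 \<noteq> \<zero>" for p
  proof -
    have var: "var \<in> carrier P" by simp
    obtain q where q: "q \<in> carrier P"
      "p = up_ring.monom P (up_ring.coeff P p 0) 0 \<oplus>\<^bsub>P\<^esub> var \<otimes>\<^bsub>P\<^esub> q"
      using poly_split[OF R p(1)] by blast
    have "(var \<otimes>\<^bsub>P\<^esub> q) [^]\<^bsub>P\<^esub> n = q [^]\<^bsub>P\<^esub> n \<otimes>\<^bsub>P\<^esub> var [^]\<^bsub>P\<^esub> n"
      using P.pow_mult_distrib[OF P.m_comm[OF var q(1)] var q(1)] q(1) var
      by (simp add: P.m_comm del: monom_pow)
    then have "(var \<otimes>\<^bsub>P\<^esub> q) [^]\<^bsub>P\<^esub> n \<in> ?I"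
      using q(1) unfolding cgenideal_def by auto
    moreover have "up_ring.coeff P p 0 \<in> Units R"
      using p field.field_Units[OF R] by simp
    ultimately show ?thesis
      using const_unit q var P.m_closed by metis
  qed
  show "up_ring.monom P d 0 \<in> Units P"
    by (rule const_unit[OF d(1)])
  show "skew (up_ring.monom P d 0) = \<ominus>\<^bsub>P\<^esub> up_ring.monom P d 0"
  proof -
    have "d \<in> carrier R" using d(1) by blast
    then show ?thesis
      using d(2) by (intro up_eqI) auto
  qed
qed

end

section \<open>Conjugation of a quadratic extension\<close>

locale quadratic_extension = field K for K (structure) +
  fixes k :: "'a set" and \<Delta> :: 'a
  assumes subfield: "subfield k K"
    and \<Delta>: "\<Delta> \<in> carrier K" "\<Delta> \<notin> k" "\<Delta> \<otimes> \<Delta> \<in> k"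
    and basis: "z \<in> carrier K \<Longrightarrow> \<exists>a\<in>k. \<exists>b\<in>k. z = a \<oplus> b \<otimes> \<Delta>"
begin

lemma k_closed [simp]:
  "\<one> \<in> k" "\<zero> \<in> k"
  "a \<in> k \<Longrightarrow> a \<in> carrier K"
  "a \<in> k \<Longrightarrow> b \<in> k \<Longrightarrow> a \<oplus> b \<in> k"
  "a \<in> k \<Longrightarrow> b \<in> k \<Longrightarrow> a \<otimes> b \<in> k"
  "a \<in> k \<Longrightarrow> \<ominus> a \<in> k"
  using subringE[OF subfieldE(1)[OF subfield]] by auto

text \<open>If \<open>b\<close> and \<open>b'\<close> differed, dividing by their difference would
  express \<open>\<Delta>\<close> by elements of \<open>k\<close>.\<close>

lemma basis_unique:
  assumes k: "a \<in> k" "b \<in> k" "a' \<in> k" "b' \<in> k" and eq: "a \<oplus> b \<otimes> \<Delta> = a' \<oplus> b' \<otimes> \<Delta>"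
  shows "a = a' \<and> b = b'"
proof -
  have carr: "a \<in> carrier K" "b \<in> carrier K" "a' \<in> carrier K" "b' \<in> carrier K"
    using k by auto
  have cancel: "x \<oplus> y \<oplus> \<ominus> x = y" if "x \<in> carrier K" "y \<in> carrier K" for x y
    using that by (simp add: a_comm[of x] a_assoc r_neg)
  have "b \<otimes> \<Delta> = a \<oplus> b \<otimes> \<Delta> \<oplus> \<ominus> a"
    using cancel carr \<Delta>(1) by simp
  also have "\<dots> = b' \<otimes> \<Delta> \<oplus> (a' \<oplus> \<ominus> a)"
    unfolding eq using carr \<Delta>(1) by (simp add: a_ac)
  finally have "b \<otimes> \<Delta> \<oplus> \<ominus> (b' \<otimes> \<Delta>) = a' \<oplus> \<ominus> a"
    using cancel carr \<Delta>(1) by simp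
  then have *: "(b \<ominus> b') \<otimes> \<Delta> = a' \<oplus> \<ominus> a"
    using carr \<Delta>(1) by (simp add: a_minus_def l_distr l_minus)
  have "b = b'"
  proof (rule ccontr)
    assume "b \<noteq> b'"
    then have "b \<ominus> b' \<noteq> \<zero>"
      using carr r_right_minus_eq by blast
    moreover have "b \<ominus> b' \<in> k"
      using k by (simp add: a_minus_def)
    ultimately have "b \<ominus> b' \<in> k - {\<zero>}"
      by blast
    moreover have "(b \<ominus> b') \<otimes> \<Delta> \<in> k"
      unfolding * using k by simp
    ultimately have "\<Delta> \<in> k"
      using subfield_m_inv_simprule[OF subfield] \<Delta>(1) by blast
    then show False using \<Delta>(2) by blast
  qed
  then show ?thesis
    using eq carr \<Delta>(1) by simp
qed

abbreviation conj where "conj \<equiv> conj_ext K k \<Delta>"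

text \<open>Uniqueness of coordinates makes the definite description in \<open>conj_ext\<close> well
  defined; all later facts on \<open>conj\<close> rest on this formula.\<close>

lemma conj_eq:
  assumes "a \<in> k" "b \<in> k"
  shows "conj (a \<oplus> b \<otimes> \<Delta>) = a \<ominus> b \<otimes> \<Delta>"
  unfolding conj_ext_def
  by (rule the_equality) (use assms basis_unique in blast)+

lemma conj_involution_ring: "involution_ring K conj"
proof unfold_locales
  show "conj \<in> ring_hom K K"
  proof (rule ring_hom_memI)
    fix x assume "x \<in> carrier K"
    then obtain a b where x: "a \<in> k" "b \<in> k" "x = a \<oplus> b \<otimes> \<Delta>"
      using basis by blast
    have c: "a \<in> carrier K" "b \<in> carrier K"
      using x by auto
    show "conj x \<in> carrier K"
      using x c \<Delta>(1) by (simp add: conj_eq)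
    fix y assume "y \<in> carrier K"
    then obtain a' b' where y: "a' \<in> k" "b' \<in> k" "y = a' \<oplus> b' \<otimes> \<Delta>"
      using basis by blast
    have c': "a' \<in> carrier K" "b' \<in> carrier K"
      using y by auto
    have "x \<oplus> y = (a \<oplus> a') \<oplus> (b \<oplus> b') \<otimes> \<Delta>"
      using c c' \<Delta>(1) unfolding x y by algebra
    then have "conj (x \<oplus> y) = (a \<oplus> a') \<ominus> (b \<oplus> b') \<otimes> \<Delta>"
      using x y by (simp add: conj_eq)
    also have "\<dots> = (a \<ominus> b \<otimes> \<Delta>) \<oplus> (a' \<ominus> b' \<otimes> \<Delta>)"
      using c c' \<Delta>(1) by algebra
    finally show "conj (x \<oplus> y) = conj x \<oplus> conj y"
      using x y by (simp add: conj_eq)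
    \<comment> \<open>Because the square of \<open>\<Delta>\<close> lies in \<open>k\<close>, the
      product is again in coordinates over \<open>k\<close> and \<open>conj_eq\<close>
      applies.\<close>
    have "x \<otimes> y = (a \<otimes> a' \<oplus> b \<otimes> b' \<otimes> (\<Delta> \<otimes> \<Delta>)) \<oplus> (a \<otimes> b' \<oplus> b \<otimes> a') \<otimes> \<Delta>"
      using c c' \<Delta>(1) unfolding x y by (simp add: l_distr r_distr a_ac m_ac)
    then have "conj (x \<otimes> y) = (a \<otimes> a' \<oplus> b \<otimes> b' \<otimes> (\<Delta> \<otimes> \<Delta>)) \<ominus> (a \<otimes> b' \<oplus> b \<otimes> a') \<otimes> \<Delta>"
      using x y \<Delta>(3) by (simp add: conj_eq)
    also have "\<dots> = (a \<ominus> b \<otimes> \<Delta>) \<otimes> (a' \<ominus> b' \<otimes> \<Delta>)"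
      using c c' \<Delta>(1)
      by (simp add: a_minus_def l_distr r_distr l_minus r_minus minus_add a_ac m_ac)
    finally show "conj (x \<otimes> y) = conj x \<otimes> conj y"
      using x y by (simp add: conj_eq)
  next
    show "conj \<one> = \<one>"
      using conj_eq[of \<one> \<zero>] \<Delta>(1) by (simp add: a_minus_def)
  qed
next
  fix x assume "x \<in> carrier K"
  then obtain a b where x: "a \<in> k" "b \<in> k" "x = a \<oplus> b \<otimes> \<Delta>"
    using basis by blast
  have "conj x = a \<oplus> (\<ominus> b) \<otimes> \<Delta>"
    using x \<Delta>(1) by (simp add: conj_eq a_minus_def l_minus)
  then have "conj (conj x) = a \<ominus> (\<ominus> b) \<otimes> \<Delta>"
    using x conj_eq[of a "\<ominus> b"] by simp
  then show "conj (conj x) = x"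
    using x \<Delta>(1) by (simp add: a_minus_def l_minus)
qed

lemma conj_\<Delta>: "conj \<Delta> = \<ominus> \<Delta>"
  using conj_eq[of \<zero> \<one>] \<Delta>(1) by (simp add: a_minus_def)

lemma \<Delta>_Units: "\<Delta> \<in> Units K"
  using \<Delta> k_closed(2) by (auto simp: field_Units)

end

text \<open>If \<open>\<Delta>\<close> were in \<open>k\<close>, the generated field would be
  \<open>k\<close>, of dimension 1 instead of 2. So \<open>\<Delta>\<close> and 1 are independent,
  and two independent elements span a space of dimension 2.\<close>

lemma (in field) quadratic_extensionI:
  assumes k: "subfield k R" and dim: "dimension 2 k (carrier R)"
    and \<Delta>: "\<Delta> \<in> carrier R" "generate_field R (insert \<Delta> k) = carrier R" "\<Delta> \<otimes> \<Delta> \<in> k"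
  shows "quadratic_extension R k \<Delta>"
proof (intro quadratic_extension.intro quadratic_extension_axioms.intro)
  note sub = subringE[OF subfieldE(1)[OF k]]
  show notin: "\<Delta> \<notin> k"
  proof
    assume "\<Delta> \<in> k"
    then have "insert \<Delta> k \<subseteq> k" by auto
    then have "carrier R \<subseteq> k"
      using generate_field_min_subfield1[of "insert \<Delta> k" k] \<Delta>(1,2) sub(1) k by auto
    then have "carrier R = k"
      using sub(1) by auto
    then have "dimension 1 k (carrier R)"
      using dimension_one[OF k] by simp
    then show False
      using dimension_is_inj[OF k dim] by fastforce
  qed
  have span1: "Span k [\<one>] = k"
  proof -
    have "u = u \<otimes> \<one> \<oplus> \<zero>" if "u \<in> k" for u
      using sub(1) that by auto
    then have "u \<in> Span k [\<one>] \<longleftrightarrow> u \<in> k" for u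
      using sub(1) by (auto simp: line_extension_mem_iff)
    then show ?thesis by blast
  qed
  have "independent k [\<one>]"
    by (rule li_Cons) auto
  then have "independent k [\<Delta>, \<one>]"
    using notin \<Delta>(1) span1 by (intro li_Cons) auto
  then have "Span k [\<Delta>, \<one>] = carrier R"
    using independent_length_eq_dimension[OF k dim, of "[\<Delta>, \<one>]"] \<Delta>(1) by auto
  then have span: "line_extension k \<Delta> k = carrier R"
    using span1 by simp
  show "\<exists>a\<in>k. \<exists>b\<in>k. z = a \<oplus> b \<otimes> \<Delta>" if z: "z \<in> carrier R" for z
  proof -
    have "z \<in> line_extension k \<Delta> k"
      using z span by simp
    then obtain b a where "b \<in> k" "a \<in> k" "z = b \<otimes> \<Delta> \<oplus> a"
      by (auto simp: line_extension_mem_iff)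
    then show ?thesis
      using sub(1) \<Delta>(1) a_comm by (metis m_closed subsetD)
  qed
qed (rule field_axioms, rule k, rule \<Delta>, rule \<Delta>)

theorem theorem1:
  fixes K :: "('a, 'm) ring_scheme" and k :: "'a set" and \<Delta> :: 'a
    and p q m n :: nat
  assumes "Factorial_Ring.prime p" and "odd p" and "m \<ge> 1" and "q = p ^ m"
    and "field K" and "subfield k K" and "finite k" and "card k = q"
    and "ring.dimension K 2 k (carrier K)"
    and "\<Delta> \<in> carrier K" and "generate_field K (insert \<Delta> k) = carrier K"
    and "\<Delta> [^]\<^bsub>K\<^esub> (2::nat) \<in> k"
    and "n \<ge> 1"
  shows "is_presented_by
    (SL_star1 (trunc_ring K n) (trunc_star K k \<Delta>))
    (bruhat_gens (trunc_ring K n) (trunc_star K k \<Delta>))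
    (bruhat_rels (trunc_ring K n) (trunc_star K k \<Delta>))
    (bruhat_matrix (trunc_ring K n) (trunc_star K k \<Delta>))"
proof -
  interpret K: field K by fact
  have "\<Delta> \<otimes>\<^bsub>K\<^esub> \<Delta> \<in> k"
    using assms(10,12) by (simp add: numeral_2_eq_2)
  then interpret quadratic_extension K k \<Delta>
    using K.quadratic_extensionI[OF assms(6,9-11)] by blast
  interpret conj: involution_ring K conj
    by (rule conj_involution_ring)
  interpret poly_involution K "UP K" conj
    by unfold_locales simp
  let ?I = "PIdl\<^bsub>UP K\<^esub> (var [^]\<^bsub>UP K\<^esub> n)"
  have "trunc_ring K n = UP K Quot ?I"
    by (simp add: trunc_ring_def poly_X_def)
  \<comment> \<open>For the involution \<open>conj\<close> the function \<open>skew\<close> has the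
    same body as \<open>poly_star\<close>.\<close>
  moreover have "trunc_star K k \<Delta> = (`) skew"
    by (simp add: fun_eq_iff trunc_star_def poly_star_def skew_def)
  \<comment> \<open>The class of the constant \<open>\<Delta>\<close> is the required skew unit,
    since \<open>conj\<close> negates \<open>\<Delta>\<close>.\<close>
  ultimately interpret local_involution_ring "trunc_ring K n" "trunc_star K k \<Delta>"
      "?I +>\<^bsub>UP K\<^esub> up_ring.monom (UP K) \<Delta> 0"
    using truncated_local_involution_ring[OF assms(5,13) \<Delta>_Units conj_\<Delta>] by simp
  show ?thesis
    by (rule SL_bruhat_presentation)
qed

end
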